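(* Let $k$ be a positive integer, let $G$ be a graph that is minimally $k$-connected or minimally $k$-edge-connected, and let $H$ be a subgraph of $G$. Then $e(H)\le k(|H|-1)$. Moreover, if $|H|\ge \frac12 k(k+5)$, then $e(H)\le k(|H|-k)$, where the equality holds if and only if $H\cong K_{k,|H|-k}$.
   Context: All graphs are finite and simple. $|H|$ and $e(H)$ denote the numbers of vertices and edges of $H$. The connectivity (resp. edge-connectivity) of a graph is the minimum number of vertices (resp. edges) whose removal results in a disconnected graph or in the trivial (one-vertex) graph. A graph is $k$-connected (resp. $k$-edge-connected) if its connectivity (resp. edge-connectivity) is at least $k$. A graph is minimally $k$-connected (resp. minimally $k$-edge-connected) if it is $k$-connected (resp. $k$-edge-connected) but deleting any one edge always leaves a graph that is not $k$-connected (resp. not $k$-edge-connected). $K_{a,b}$ is the complete bipartite graph with parts of sizes $a$ and $b$. Subgraphs need not be induced.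
   Formalization: For k = 1 the claim that equality forces H ≅ K_{k,|H|-k} is false (G = H = the path on 4 vertices), so that direction is stated only for k ≥ 2; both bounds and the converse are stated for all k ≥ 1. *)

theory Defs
  imports Complex_Main "Graph_Theory.Graph_Theory"
begin

text \<open>
  A finite simple graph is a \<^locale>\<open>pair_graph\<close>: a finite, symmetric, loop-free digraph whose
  arcs are pairs of vertices. An undirected edge between \<open>u\<close> and \<open>v\<close> is represented by the two
  arcs \<open>(u, v)\<close> and \<open>(v, u)\<close>; \<open>uedges\<close> identifies them, so that \<open>e(H)\<close> is \<open>card (uedges H)\<close>.
\<close>

definition uedges :: "'a pair_pre_digraph \<Rightarrow> 'a set set" where
  "uedges G = (\<lambda>(u, v). {u, v}) ` parcs G"

definition remove_verts :: "'a pair_pre_digraph \<Rightarrow> 'a set \<Rightarrow> 'a pair_pre_digraph" where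
  "remove_verts G S =
     \<lparr> pverts = pverts G - S, parcs = {(u, v) \<in> parcs G. u \<notin> S \<and> v \<notin> S} \<rparr>"

definition remove_edges :: "'a pair_pre_digraph \<Rightarrow> 'a set set \<Rightarrow> 'a pair_pre_digraph" where
  "remove_edges G F =
     \<lparr> pverts = pverts G, parcs = {(u, v) \<in> parcs G. {u, v} \<notin> F} \<rparr>"

text \<open>
  The constant \<^const>\<open>connected\<close> is false for the graph without vertices, which is not to count
  as disconnected.
\<close>

definition disconnected_or_trivial :: "'a pair_pre_digraph \<Rightarrow> bool" where
  "disconnected_or_trivial G \<longleftrightarrow>
     (pverts G \<noteq> {} \<and> \<not> connected (with_proj G)) \<or> card (pverts G) = 1"

text \<open>
  The sets over which these minima are taken are non-empty whenever \<open>G\<close> has a vertex: keep only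
  one vertex, respectively remove all edges.
\<close>

definition connectivity :: "'a pair_pre_digraph \<Rightarrow> nat" where
  "connectivity G =
     (LEAST n. \<exists>S \<subseteq> pverts G. card S = n \<and> disconnected_or_trivial (remove_verts G S))"

definition edge_connectivity :: "'a pair_pre_digraph \<Rightarrow> nat" where
  "edge_connectivity G =
     (LEAST n. \<exists>F \<subseteq> uedges G. card F = n \<and> disconnected_or_trivial (remove_edges G F))"

definition k_connected :: "nat \<Rightarrow> 'a pair_pre_digraph \<Rightarrow> bool" where
  "k_connected k G \<longleftrightarrow> k \<le> connectivity G"

definition k_edge_connected :: "nat \<Rightarrow> 'a pair_pre_digraph \<Rightarrow> bool" where
  "k_edge_connected k G \<longleftrightarrow> k \<le> edge_connectivity G"

definition minimally_k_connected :: "nat \<Rightarrow> 'a pair_pre_digraph \<Rightarrow> bool" where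
  "minimally_k_connected k G \<longleftrightarrow>
     k_connected k G \<and> (\<forall>e \<in> uedges G. \<not> k_connected k (remove_edges G {e}))"

definition minimally_k_edge_connected :: "nat \<Rightarrow> 'a pair_pre_digraph \<Rightarrow> bool" where
  "minimally_k_edge_connected k G \<longleftrightarrow>
     k_edge_connected k G \<and> (\<forall>e \<in> uedges G. \<not> k_edge_connected k (remove_edges G {e}))"

end

theory Submission
  imports Defs
begin

text \<open>
  In both cases every edge \<open>xy\<close> of \<open>G\<close>, hence of \<open>H\<close>, can be cut by deleting \<open>xy\<close> together with
  fewer than \<open>k\<close> further vertices. The last vertex of a maximum adjacency order of a graph with this
  property has degree at most \<open>k\<close>, so that \<open>H\<close> is \<open>k\<close>-degenerate; this gives \<open>e(H) \<le> k(|H| - 1)\<close>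
  and, more precisely, \<open>e(H) \<le> k|H| - k(k+1)/2\<close>.

  For large \<open>H\<close> let \<open>M\<close> be the set of vertices of degree greater than \<open>k\<close> in \<open>H\<close>. If \<open>M\<close> is
  independent, counting the edges at the vertices of degree at most \<open>k\<close> gives
  \<open>e(H) \<le> k(|H| - k)\<close>, with equality only for \<open>K\<^bsub>k,|H|-k\<^esub>\<close>. If \<open>G\<close> is minimally \<open>k\<close>-connected,
  \<open>M\<close> induces a forest by Mader's theorem (an uncrossing argument in \<open>G\<close>), and the few edges inside
  \<open>M\<close> are outweighed because adjacent vertices have fewer than \<open>k\<close> common neighbours. If \<open>G\<close> is
  minimally \<open>k\<close>-edge-connected, vertices of degree less than \<open>k\<close> can be removed one by one, and then
  an edge inside \<open>M\<close> yields a cut with at most \<open>k\<close> edges and more than \<open>k\<close> vertices on both sides,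
  to which the degeneracy bound applies separately.
\<close>

section \<open>Degrees and edge counts\<close>

text \<open>A graph is a relation together with a vertex set, so that passing to an induced subgraph
  changes only the set.\<close>

definition degree_in :: "('a \<Rightarrow> 'a \<Rightarrow> bool) \<Rightarrow> 'a set \<Rightarrow> 'a \<Rightarrow> nat" where
  "degree_in E W v = card {u \<in> W. E v u}"

text \<open>Every edge inside \<open>W\<close> is counted twice in \<open>arc_count E W W\<close>.\<close>

definition arc_count :: "('a \<Rightarrow> 'a \<Rightarrow> bool) \<Rightarrow> 'a set \<Rightarrow> 'a set \<Rightarrow> nat" where
  "arc_count E X Y = (\<Sum>v\<in>X. degree_in E Y v)"

text \<open>
  A mixed separation: \<open>S\<close> together with the edge \<open>xy\<close> separates \<open>x\<close> from \<open>y\<close>, so there are at most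
  \<open>card S + 1\<close> internally disjoint paths between them. Unlike \<open>k\<close>-connectedness, the resulting notion
  of sparseness passes to subgraphs.
\<close>

definition separates ::
  "('a \<Rightarrow> 'a \<Rightarrow> bool) \<Rightarrow> 'a set \<Rightarrow> 'a set \<Rightarrow> 'a set \<Rightarrow> 'a set \<Rightarrow> 'a \<Rightarrow> 'a \<Rightarrow> bool" where
  "separates E V A S B x y \<longleftrightarrow>
     A \<union> S \<union> B = V \<and> A \<inter> S = {} \<and> A \<inter> B = {} \<and> S \<inter> B = {} \<and> x \<in> A \<and> y \<in> B \<and>
     (\<forall>u\<in>A. \<forall>w\<in>B. E u w \<longrightarrow> u = x \<and> w = y)"

definition locally_sparse :: "nat \<Rightarrow> ('a \<Rightarrow> 'a \<Rightarrow> bool) \<Rightarrow> 'a set \<Rightarrow> bool" where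
  "locally_sparse k E V \<longleftrightarrow>
     (\<forall>x\<in>V. \<forall>y\<in>V. E x y \<longrightarrow> (\<exists>A S B. separates E V A S B x y \<and> card S < k))"

text \<open>In a minimally k-edge-connected graph, deleting \<open>xy\<close> lets fewer than
  \<open>k\<close> further edges disconnect the graph, so \<open>xy\<close> lies in a cut with at
  most \<open>k\<close> edges.\<close>

definition edge_sparse :: "nat \<Rightarrow> ('a \<Rightarrow> 'a \<Rightarrow> bool) \<Rightarrow> 'a set \<Rightarrow> bool" where
  "edge_sparse k E V \<longleftrightarrow>
     (\<forall>x\<in>V. \<forall>y\<in>V. E x y \<longrightarrow> (\<exists>A\<subseteq>V. x \<in> A \<and> y \<in> V - A \<and> arc_count E A (V - A) \<le> k))"

definition complete_between :: "('a \<Rightarrow> 'a \<Rightarrow> bool) \<Rightarrow> 'a set \<Rightarrow> 'a set \<Rightarrow> bool" where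
  "complete_between E V U \<longleftrightarrow> (\<forall>u\<in>V. \<forall>v\<in>V. E u v \<longleftrightarrow> (u \<in> U) \<noteq> (v \<in> U))"

section \<open>Arithmetic of degrees and arc counts\<close>

lemma degree_in_mono: "finite Y \<Longrightarrow> X \<subseteq> Y \<Longrightarrow> degree_in E X v \<le> degree_in E Y v"
  unfolding degree_in_def by (rule card_mono) auto

lemma degree_in_rel_mono:
  "finite Y \<Longrightarrow> (\<And>u v. E u v \<Longrightarrow> E' u v) \<Longrightarrow> degree_in E Y v \<le> degree_in E' Y v"
  unfolding degree_in_def by (rule card_mono) auto

lemma degree_in_le_card: "finite Y \<Longrightarrow> degree_in E Y v \<le> card Y"
  unfolding degree_in_def by (rule card_mono) auto

lemma degree_in_Un:
  assumes "finite X" "finite Y" "X \<inter> Y = {}"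
  shows "degree_in E (X \<union> Y) v = degree_in E X v + degree_in E Y v"
proof -
  have "{u \<in> X \<union> Y. E v u} = {u \<in> X. E v u} \<union> {u \<in> Y. E v u}" by auto
  then show ?thesis
    unfolding degree_in_def using assms by (simp add: card_Un_disjoint disjoint_iff)
qed

lemma degree_in_singleton: "degree_in E {u} v = (if E v u then 1 else 0)"
proof -
  have "{w \<in> {u}. E v w} = (if E v u then {u} else {})" by auto
  then show ?thesis by (simp add: degree_in_def)
qed

lemma degree_in_insert:
  "finite X \<Longrightarrow> u \<notin> X \<Longrightarrow> degree_in E (insert u X) v = degree_in E X v + (if E v u then 1 else 0)"
  using degree_in_Un[of X "{u}" E v] by (simp add: degree_in_singleton)

lemma degree_in_conv_sum: "finite Y \<Longrightarrow> degree_in E Y v = (\<Sum>u\<in>Y. if E v u then 1 else 0)"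
  unfolding degree_in_def by (simp add: sum.If_cases Int_def)

lemma arc_count_mono:
  assumes "finite X'" "finite Y'" "X \<subseteq> X'" "Y \<subseteq> Y'"
  shows "arc_count E X Y \<le> arc_count E X' Y'"
proof -
  have "arc_count E X Y \<le> (\<Sum>v\<in>X. degree_in E Y' v)"
    unfolding arc_count_def using assms by (intro sum_mono degree_in_mono)
  also have "\<dots> \<le> arc_count E X' Y'"
    unfolding arc_count_def using assms by (intro sum_mono2) auto
  finally show ?thesis .
qed

lemma arc_count_rel_mono:
  "finite Y \<Longrightarrow> (\<And>u v. E u v \<Longrightarrow> E' u v) \<Longrightarrow> arc_count E X Y \<le> arc_count E' X Y"
  unfolding arc_count_def by (intro sum_mono degree_in_rel_mono)

lemma arc_count_Un_left:
  "finite X \<Longrightarrow> finite Y \<Longrightarrow> X \<inter> Y = {} \<Longrightarrow>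
    arc_count E (X \<union> Y) Z = arc_count E X Z + arc_count E Y Z"
  unfolding arc_count_def by (rule sum.union_disjoint)

lemma arc_count_Un_right:
  "finite X \<Longrightarrow> finite Y \<Longrightarrow> X \<inter> Y = {} \<Longrightarrow>
    arc_count E Z (X \<union> Y) = arc_count E Z X + arc_count E Z Y"
  unfolding arc_count_def by (simp add: degree_in_Un sum.distrib)

lemma arc_count_le: "finite Y \<Longrightarrow> arc_count E X Y \<le> card X * card Y"
  unfolding arc_count_def
  using sum_bounded_above[of X "degree_in E Y" "card Y"] by (simp add: degree_in_le_card)

lemma arc_count_eq_card:
  assumes "finite X" "finite Y"
  shows "arc_count E X Y = card {(u, w). u \<in> X \<and> w \<in> Y \<and> E u w}"
proof -
  have "{(u, w). u \<in> X \<and> w \<in> Y \<and> E u w} = (SIGMA u:X. {w \<in> Y. E u w})" by auto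
  then show ?thesis using assms by (simp add: arc_count_def degree_in_def)
qed

lemma separates_Diff:
  assumes "A \<subseteq> V" "S \<subseteq> V" "A \<inter> S = {}" "x \<in> A" "y \<in> V - A - S"
    and "\<And>u w. u \<in> A \<Longrightarrow> w \<in> V - A - S \<Longrightarrow> E u w \<Longrightarrow> u = x \<and> w = y"
  shows "separates E V A S (V - A - S) x y"
  using assms(1-5) by (simp add: separates_def) (use assms(6) in auto)

lemma card_Un3_le: "card (X \<union> Y \<union> Z) \<le> card X + card Y + card Z"
  using card_Un_le[of "X \<union> Y" Z] card_Un_le[of X Y] by linarith

text \<open>A separation of the edge in the larger graph, intersected with \<open>W\<close>, still
  separates it in the smaller one, and \<open>S\<close> only shrinks.\<close>

lemma locally_sparse_mono:
  assumes "finite V" "locally_sparse k E V" "W \<subseteq> V" "\<And>u v. E' u v \<Longrightarrow> E u v"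
  shows "locally_sparse k E' W"
  unfolding locally_sparse_def
proof (intro ballI impI)
  fix x y assume xy: "x \<in> W" "y \<in> W" "E' x y"
  then obtain A S B where s: "separates E V A S B x y" "card S < k"
    using assms unfolding locally_sparse_def by (meson subsetD)
  have "finite S" using s(1) assms(1) unfolding separates_def by (auto intro: finite_subset)
  then have "card (S \<inter> W) < k" using s(2) by (meson card_mono inf_le1 le_less_trans)
  moreover have "separates E' W (A \<inter> W) (S \<inter> W) (B \<inter> W) x y"
    using s(1) xy assms(3,4) unfolding separates_def by blast
  ultimately show "\<exists>A S B. separates E' W A S B x y \<and> card S < k" by blast
qed

lemma edge_sparse_mono:
  assumes "finite V" "edge_sparse k E V" "W \<subseteq> V" "\<And>u v. E' u v \<Longrightarrow> E u v"
  shows "edge_sparse k E' W"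
  unfolding edge_sparse_def
proof (intro ballI impI)
  fix x y assume xy: "x \<in> W" "y \<in> W" "E' x y"
  then obtain A where A: "A \<subseteq> V" "x \<in> A" "y \<in> V - A" "arc_count E A (V - A) \<le> k"
    using assms unfolding edge_sparse_def by (meson subsetD)
  have "arc_count E' (A \<inter> W) (W - A \<inter> W) \<le> arc_count E (A \<inter> W) (W - A \<inter> W)"
    using assms by (intro arc_count_rel_mono) (auto intro: finite_subset)
  also have "\<dots> \<le> arc_count E A (V - A)"
    using assms A(1) by (intro arc_count_mono) (auto intro: finite_subset)
  finally show "\<exists>A\<subseteq>W. x \<in> A \<and> y \<in> W - A \<and> arc_count E' A (W - A) \<le> k"
    using A xy by (intro exI[of _ "A \<inter> W"]) auto
qed

locale simple_relation =
  fixes E :: "'a \<Rightarrow> 'a \<Rightarrow> bool"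
  assumes adj_sym: "E u v \<Longrightarrow> E v u" and adj_irrefl: "\<not> E v v"
begin

lemma arc_count_commute:
  assumes "finite X" "finite Y"
  shows "arc_count E X Y = arc_count E Y X"
proof -
  have "(\<Sum>v\<in>X. \<Sum>u\<in>Y. if E v u then 1 else 0) = (\<Sum>u\<in>Y. \<Sum>v\<in>X. if E u v then 1 else (0::nat))"
    by (subst sum.swap) (intro sum.cong refl if_cong, auto dest: adj_sym)
  then show ?thesis using assms by (simp add: arc_count_def degree_in_conv_sum)
qed

lemma arc_count_Un:
  assumes "finite X" "finite Y" "X \<inter> Y = {}"
  shows "arc_count E (X \<union> Y) (X \<union> Y) = arc_count E X X + 2 * arc_count E X Y + arc_count E Y Y"
  using assms arc_count_commute[of X Y] by (simp add: arc_count_Un_left arc_count_Un_right)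

lemma arc_count_remove:
  assumes "finite W" "v \<in> W"
  shows "arc_count E W W = arc_count E (W - {v}) (W - {v}) + 2 * degree_in E W v"
proof -
  have W: "W = {v} \<union> (W - {v})" using assms by auto
  have "arc_count E W W =
      arc_count E {v} {v} + 2 * arc_count E {v} (W - {v}) + arc_count E (W - {v}) (W - {v})"
    using arc_count_Un[of "{v}" "W - {v}"] assms by (simp add: insert_absorb)
  moreover have "degree_in E W v = degree_in E (W - {v}) v"
    unfolding degree_in_def using adj_irrefl by (metis Diff_iff singletonD)
  ultimately show ?thesis
    using adj_irrefl by (simp add: arc_count_def degree_in_singleton)
qed

lemma separates_commute: "separates E V A S B x y \<Longrightarrow> separates E V B S A y x"
  unfolding separates_def using adj_sym by (metis Int_commute Un_assoc Un_commute)

text \<open>A common neighbour on either side would send a second edge across, to the opposite end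
  of \<open>xy\<close>.\<close>

lemma common_neighbours_subset:
  assumes "separates E V A S B x y" "E x y" "w \<in> V" "E x w" "E y w"
  shows "w \<in> S"
proof (rule ccontr)
  assume "w \<notin> S"
  then consider "w \<in> A" | "w \<in> B" using assms(1,3) unfolding separates_def by blast
  then show False
  proof cases
    case 1
    then have "w = x" using assms(1) adj_sym[OF assms(5)] unfolding separates_def by blast
    then show False using assms(4) adj_irrefl by blast
  next
    case 2
    then have "w = y" using assms(1,4) unfolding separates_def by blast
    then show False using assms(5) adj_irrefl by blast
  qed
qed

lemma card_common_neighbours:
  assumes "finite V" "locally_sparse k E V" "x \<in> V" "y \<in> V" "E x y"
  shows "card {w \<in> V. E x w \<and> E y w} < k"
proof -
  obtain A S B where s: "separates E V A S B x y" "card S < k"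
    using assms unfolding locally_sparse_def by meson
  have "{w \<in> V. E x w \<and> E y w} \<subseteq> S" using common_neighbours_subset[OF s(1) assms(5)] by auto
  moreover have "finite S" using s(1) assms(1) unfolding separates_def by (auto intro: finite_subset)
  ultimately show ?thesis using s(2) by (meson card_mono le_less_trans)
qed

section \<open>Maximum adjacency orders and degeneracy\<close>

text \<open>The length \<open>n\<close> is kept variable for the greedy induction; the order is used
  later with \<open>n = card W\<close>.\<close>

lemma ex_maximum_adjacency_order:
  assumes "finite W" "n \<le> card W"
  shows "\<exists>f. \<forall>j<n. f j \<in> W - f ` {..<j} \<and>
    (\<forall>u \<in> W - f ` {..<j}. degree_in E (f ` {..<j}) u \<le> degree_in E (f ` {..<j}) (f j))"
  using assms(2)
proof (induction n)
  case 0
  then show ?case by simp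
next
  case (Suc n)
  note Suc.IH[OF Suc_leD[OF Suc.prems]]
  then obtain f where f: "\<forall>j<n. f j \<in> W - f ` {..<j} \<and>
    (\<forall>u \<in> W - f ` {..<j}. degree_in E (f ` {..<j}) u \<le> degree_in E (f ` {..<j}) (f j))" ..
  have "card (f ` {..<n}) \<le> n" using card_image_le[of "{..<n}" f] by simp
  then have "\<not> W \<subseteq> f ` {..<n}"
    using Suc.prems card_mono[of "f ` {..<n}" W] by auto
  then have "W - f ` {..<n} \<noteq> {}" by blast
  moreover have "finite (W - f ` {..<n})" using assms by simp
  ultimately have "Max (degree_in E (f ` {..<n}) ` (W - f ` {..<n}))
      \<in> degree_in E (f ` {..<n}) ` (W - f ` {..<n})"
    by (intro Max_in) auto
  then obtain v where v: "v \<in> W - f ` {..<n}"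
      "degree_in E (f ` {..<n}) v = Max (degree_in E (f ` {..<n}) ` (W - f ` {..<n}))" by auto
  have vmax: "degree_in E (f ` {..<n}) u \<le> degree_in E (f ` {..<n}) v" if "u \<in> W - f ` {..<n}" for u
    unfolding v(2) using that assms(1) by (intro Max_ge) auto
  have img: "(f(n := v)) ` {..<j} = f ` {..<j}" if "j \<le> n" for j
    using that by (intro image_cong) auto
  show ?case
  proof (intro exI[of _ "f(n := v)"] allI impI)
    fix j assume "j < Suc n"
    then show "(f(n := v)) j \<in> W - (f(n := v)) ` {..<j} \<and>
      (\<forall>u \<in> W - (f(n := v)) ` {..<j}. degree_in E ((f(n := v)) ` {..<j}) u
         \<le> degree_in E ((f(n := v)) ` {..<j}) ((f(n := v)) j))"
      using f v(1) vmax img[of j] by (cases "j = n") auto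
  qed
qed

text \<open>The last vertex \<open>y\<close> of a maximum adjacency order qualifies. If
  \<open>x\<close> is its latest neighbour and \<open>y\<close> had degree above \<open>k\<close>,
  then \<open>y\<close>, and by maximality also \<open>x\<close>, would have at least
  \<open>k\<close> neighbours before \<open>x\<close>, whereas the separation of \<open>xy\<close>
  limits one of the two to \<open>card S\<close>.\<close>

lemma ex_degree_le:
  assumes "finite W" "W \<noteq> {}" "locally_sparse k E W"
  shows "\<exists>v\<in>W. degree_in E W v \<le> k"
proof -
  define n where "n = card W"
  have n: "n > 0" using assms by (simp add: n_def card_gt_0_iff)
  obtain f where f: "\<And>j. j < n \<Longrightarrow> f j \<in> W - f ` {..<j}"
    and mx: "\<And>j u. j < n \<Longrightarrow> u \<in> W - f ` {..<j} \<Longrightarrow>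
      degree_in E (f ` {..<j}) u \<le> degree_in E (f ` {..<j}) (f j)"
    using ex_maximum_adjacency_order[OF assms(1), of n] n_def by blast
  have "f i \<noteq> f j" if "i < j" "j < n" for i j
    using f[OF that(2)] that(1) by (metis DiffD2 imageI lessThan_iff)
  then have inj: "inj_on f {..<n}" by (intro inj_onI) (metis lessThan_iff linorder_neqE_nat)
  have img: "f ` {..<n} = W"
    using f inj assms(1) by (intro card_subset_eq) (auto simp: card_image n_def)
  define y where "y = f (n - 1)"
  have y: "y \<in> W" using f[of "n - 1"] n by (auto simp: y_def)
  show ?thesis
  proof (rule ccontr)
    assume "\<not> ?thesis"
    then have dy: "degree_in E W y > k" using y by (auto simp: not_le)
    then have "{u \<in> W. E y u} \<noteq> {}" unfolding degree_in_def by (metis card.empty not_less0)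
    then have "{i. i < n \<and> E y (f i)} \<noteq> {}" using img by auto
    moreover have fin: "finite {i. i < n \<and> E y (f i)}" by simp
    ultimately have mem: "Max {i. i < n \<and> E y (f i)} \<in> {i. i < n \<and> E y (f i)}" by (intro Max_in)
    define i where "i = Max {i. i < n \<and> E y (f i)}"
    have i: "i < n" "E y (f i)" using mem by (auto simp: i_def)
    have last: "j \<le> i" if "j < n" "E y (f j)" for j
      unfolding i_def using that by (intro Max_ge[OF fin]) auto
    have i1: "i < n - 1" 
    proof -
      have "i \<noteq> n - 1" using i(2) adj_irrefl unfolding y_def by metis
      then show ?thesis using i(1) by linarith
    qed
    define x where "x = f i"
    have x: "x \<in> W" "E x y" using f[OF i(1)] adj_sym[OF i(2)] by (auto simp: x_def)
    obtain A S B where s: "separates E W A S B x y" and cS: "card S < k"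
      using assms(3) x y unfolding locally_sparse_def by meson
    have parts: "A \<union> S \<union> B = W" "A \<inter> S = {}" "A \<inter> B = {}" "S \<inter> B = {}" "x \<in> A" "y \<in> B"
      and only: "\<And>u w. u \<in> A \<Longrightarrow> w \<in> B \<Longrightarrow> E u w \<Longrightarrow> u = x \<and> w = y"
      using s unfolding separates_def by blast+
    \<comment> \<open>Initial segments of the order cannot attach two vertices on different sides more firmly than
      through \<open>S\<close>: a new vertex \<open>v\<close> of \<open>A\<close> is not adjacent to \<open>b\<close>, and by the choice of \<open>v\<close> it is
      \<open>b\<close> that attains the minimum for the pair \<open>v\<close>, \<open>b\<close>.\<close>
    have Q: "min (degree_in E (f ` {..<j}) a) (degree_in E (f ` {..<j}) b) \<le> card (S \<inter> f ` {..<j})"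
      if "j \<le> i" "a \<in> A - f ` {..<j}" "b \<in> B - f ` {..<j}" for j a b
      using that
    proof (induction j arbitrary: a b)
      case 0
      then show ?case by (simp add: degree_in_def)
    next
      case (Suc j)
      let ?U = "f ` {..<j}"
      define v where "v = f j"
      have U: "f ` {..<Suc j} = insert v ?U" by (simp add: lessThan_Suc v_def)
      have vU: "v \<in> W - ?U" using f[of j] Suc.prems i by (auto simp: v_def)
      \<comment> \<open>Only \<open>xy\<close> may cross from \<open>A\<close> to \<open>B\<close>;
        as \<open>v\<close> precedes both ends, no edge at \<open>v\<close> does.\<close>
      have vx: "v \<noteq> x" "v \<noteq> y"
        using inj_onD[OF inj, of j i] inj_onD[OF inj, of j "n - 1"] Suc.prems(1) i(1) i1
        unfolding v_def x_def y_def by auto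
      have ab: "a \<in> A" "b \<in> B" "a \<notin> ?U" "b \<notin> ?U" using Suc.prems U by auto
      have aW: "a \<in> W - ?U" "b \<in> W - ?U" using ab parts by auto
      have dv: "degree_in E ?U u \<le> degree_in E ?U v" if "u \<in> W - ?U" for u
        using mx[of j u] that Suc.prems i(1) by (simp add: v_def)
      consider "v \<in> S" | "v \<in> A" | "v \<in> B" using vU parts by auto
      then show ?case
      proof cases
        case 1
        have "min (degree_in E ?U a) (degree_in E ?U b) \<le> card (S \<inter> ?U)"
          using Suc.IH[of a b] Suc.prems(1) ab by auto
        moreover have "card (S \<inter> insert v ?U) = Suc (card (S \<inter> ?U))" using 1 vU by simp
        moreover have "degree_in E (insert v ?U) u \<le> Suc (degree_in E ?U u)" for u
          using vU by (simp add: degree_in_insert)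
        ultimately show ?thesis unfolding U min_le_iff_disj by (metis Suc_le_mono le_trans)
      next
        case 2
        have "\<not> E b v" using only[of v b] 2 ab vx adj_sym by blast
        then have "degree_in E (insert v ?U) b = degree_in E ?U b" using vU by (simp add: degree_in_insert)
        moreover have "min (degree_in E ?U v) (degree_in E ?U b) \<le> card (S \<inter> ?U)"
          using Suc.IH[of v b] Suc.prems(1) ab 2 vU by auto
        moreover have "S \<inter> insert v ?U = S \<inter> ?U" using 2 parts by auto
        ultimately show ?thesis unfolding U using dv[OF aW(2)] by simp
      next
        case 3
        have "\<not> E a v" using only[of a v] 3 ab vx by blast
        then have "degree_in E (insert v ?U) a = degree_in E ?U a" using vU by (simp add: degree_in_insert)
        moreover have "min (degree_in E ?U a) (degree_in E ?U v) \<le> card (S \<inter> ?U)"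
          using Suc.IH[of a v] Suc.prems(1) ab 3 vU by auto
        moreover have "S \<inter> insert v ?U = S \<inter> ?U" using 3 parts by auto
        ultimately show ?thesis unfolding U using dv[OF aW(1)] by simp
      qed
    qed
    let ?U = "f ` {..<i}"
    have xU: "x \<in> W - ?U" using f[OF i(1)] by (simp add: x_def)
    have yU: "y \<in> W - ?U"
    proof -
      have "y \<noteq> f j" if "j < i" for j
        using inj_onD[OF inj, of "n - 1" j] that i(1) i1 unfolding y_def by auto
      then show ?thesis using y by auto
    qed
    have "{u \<in> W. E y u} \<subseteq> insert x {u \<in> ?U. E y u}"
    proof
      fix u assume "u \<in> {u \<in> W. E y u}"
      then obtain j where "j < n" "u = f j" "E y u" using img by auto
      then show "u \<in> insert x {u \<in> ?U. E y u}" using last[of j] by (cases "j = i") (auto simp: x_def)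
    qed
    then have "degree_in E W y \<le> card (insert x {u \<in> ?U. E y u})"
      unfolding degree_in_def by (intro card_mono) auto
    also have "\<dots> \<le> Suc (degree_in E ?U y)"
      unfolding degree_in_def by (simp add: card_insert_if)
    finally have "degree_in E W y \<le> Suc (degree_in E ?U y)" .
    then have "k \<le> degree_in E ?U y" using dy by simp
    moreover have "degree_in E ?U y \<le> degree_in E ?U x" using mx[OF i(1) yU] by (simp add: x_def)
    ultimately have "k \<le> card (S \<inter> ?U)" using Q[of i x y] parts xU yU by auto
    moreover have "card (S \<inter> ?U) \<le> card S"
      using parts assms(1) by (intro card_mono) (auto intro: finite_subset)
    ultimately show False using cS by simp
  qed
qed

section \<open>Edge bounds obtained by removing vertices of small degree\<close>

lemma locally_sparse_subset: "finite V \<Longrightarrow> locally_sparse k E V \<Longrightarrow> W \<subseteq> V \<Longrightarrow> locally_sparse k E W"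
  by (rule locally_sparse_mono)

lemma edge_sparse_subset: "finite V \<Longrightarrow> edge_sparse k E V \<Longrightarrow> W \<subseteq> V \<Longrightarrow> edge_sparse k E W"
  by (rule edge_sparse_mono)

lemma arc_count_le_linear:
  assumes "finite V" "card V = Suc n" "locally_sparse k E V"
  shows "arc_count E V V \<le> 2 * k * n"
  using assms
proof (induction n arbitrary: V)
  case 0
  then obtain v where "V = {v}" by (metis One_nat_def card_1_singletonE)
  then show ?case using adj_irrefl by (simp add: arc_count_def degree_in_singleton)
next
  case (Suc n)
  then obtain v where v: "v \<in> V" "degree_in E V v \<le> k" using ex_degree_le[of V k] by fastforce
  then have "arc_count E (V - {v}) (V - {v}) \<le> 2 * k * n"
    using Suc.prems locally_sparse_subset[of V k "V - {v}"] by (intro Suc.IH) auto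
  then show ?case using arc_count_remove[OF Suc.prems(1) v(1)] v(2) by simp
qed

lemma degree_in_less_card:
  assumes "finite W" "v \<in> W"
  shows "degree_in E W v \<le> card W - 1"
proof -
  have "{u \<in> W. E v u} \<subseteq> W - {v}" using adj_irrefl by auto
  then have "degree_in E W v \<le> card (W - {v})"
    unfolding degree_in_def using assms by (intro card_mono) auto
  then show ?thesis using assms by simp
qed

lemma arc_count_le_complete:
  assumes "finite W"
  shows "arc_count E W W \<le> card W * (card W - 1)"
  unfolding arc_count_def
  using sum_bounded_above[of W "degree_in E W" "card W - 1"] degree_in_less_card[OF assms] by simp

text \<open>Removal stops at \<open>k\<close> vertices, which carry at most
  \<open>k * (k - 1)\<close> arcs. In edges the bound reads e <= k * card V - k * (k + 1) /
  2.\<close>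

lemma arc_count_le_degenerate:
  assumes "finite V" "card V = k + n" "locally_sparse k E V"
  shows "arc_count E V V + k * (k + 1) \<le> 2 * k * (k + n)"
  using assms
proof (induction n arbitrary: V)
  case 0
  then have "arc_count E V V \<le> k * (k - 1)" using arc_count_le_complete[of V] by simp
  then show ?case by (cases k) auto
next
  case (Suc n)
  then have "V \<noteq> {}" by auto
  then obtain v where v: "v \<in> V" "degree_in E V v \<le> k" using ex_degree_le[of V k] Suc.prems by blast
  then have "arc_count E (V - {v}) (V - {v}) + k * (k + 1) \<le> 2 * k * (k + n)"
    using Suc.prems locally_sparse_subset[of V k "V - {v}"] by (intro Suc.IH) auto
  then show ?case using arc_count_remove[OF Suc.prems(1) v(1)] v(2) by simp
qed

text \<open>A missing edge lowers the degrees of both its ends, so it costs two arcs and a deficit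
  of one cannot occur.\<close>

lemma complete_if_arc_count_ge:
  assumes "finite W" "arc_count E W W + 1 \<ge> card W * (card W - 1)" "u \<in> W" "v \<in> W" "u \<noteq> v"
  shows "E u v"
proof (rule ccontr)
  assume uv: "\<not> E u v"
  have less: "degree_in E W a \<le> card W - 2" if "a \<in> W" "b \<in> W" "a \<noteq> b" "\<not> E a b" for a b
  proof -
    have "{w \<in> W. E a w} \<subseteq> W - {a, b}" using adj_irrefl that by auto
    then have "degree_in E W a \<le> card (W - {a, b})"
      unfolding degree_in_def using assms(1) by (intro card_mono) auto
    then show ?thesis using assms(1) that by (simp add: card_Diff_subset)
  qed
  have W: "arc_count E W W = degree_in E W u + (degree_in E W v + (\<Sum>w\<in>W - {u} - {v}. degree_in E W w))"
    unfolding arc_count_def using assms by (simp add: sum.remove[of W u] sum.remove[of "W - {u}" v])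
  have "(\<Sum>w\<in>W - {u} - {v}. degree_in E W w) \<le> (card W - 2) * (card W - 1)"
    using sum_bounded_above[of "W - {u} - {v}" "degree_in E W" "card W - 1"]
      degree_in_less_card[OF assms(1)] assms by (simp add: numeral_2_eq_2)
  moreover have "card W \<ge> 2"
    using card_mono[of W "{u, v}"] assms by simp
  then obtain c where "card W = c + 2" by (metis add.commute le_Suc_ex)
  ultimately show False
    using W less[of u v] less[of v u] assms uv adj_sym[of v u] by (auto simp: algebra_simps)
qed

text \<open>Attaining the degeneracy bound on \<open>k + 2\<close> vertices would mean a vertex
  \<open>v\<close> of degree \<open>k\<close> attached to a complete graph on \<open>k + 1\<close>
  vertices. Two neighbours of \<open>v\<close> would then have all other \<open>k\<close> vertices
  in common, too many for adjacent vertices.\<close>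

lemma arc_count_less_degenerate:
  assumes "finite V" "card V = k + 2 + n" "locally_sparse k E V" "k \<ge> 2"
  shows "arc_count E V V + k * (k + 1) + 2 \<le> 2 * k * (k + 2 + n)"
  using assms(1-3)
proof (induction n arbitrary: V)
  case 0
  then have "V \<noteq> {}" by auto
  then obtain v where v: "v \<in> V" "degree_in E V v \<le> k" using ex_degree_le[of V k] 0 by blast
  let ?W = "V - {v}"
  have cW: "card ?W = k + 1" "finite ?W" using 0 v by auto
  have rem: "arc_count E V V = arc_count E ?W ?W + 2 * degree_in E V v"
    using arc_count_remove[OF 0(1) v(1)] .
  have leW: "arc_count E ?W ?W \<le> (k + 1) * k" using arc_count_le_complete[OF cW(2)] cW by simp
  show ?case
  proof (rule ccontr)
    assume neg: "\<not> ?thesis"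
    then have big: "arc_count E V V + 1 \<ge> k * k + 3 * k" by (simp add: algebra_simps)
    then have dv: "degree_in E V v = k" using rem leW v(2) by (auto simp: algebra_simps)
    then have "arc_count E ?W ?W + 1 \<ge> (k + 1) * k" using rem big by (auto simp: algebra_simps)
    then have complete: "E u w" if "u \<in> ?W" "w \<in> ?W" "u \<noteq> w" for u w
      using complete_if_arc_count_ge[OF cW(2)] cW that by simp
    have "card {u \<in> V. E v u} \<ge> 2" using dv assms(4) by (simp add: degree_in_def)
    then obtain p q where pq: "p \<in> V" "q \<in> V" "E v p" "E v q" "p \<noteq> q"
      by (auto simp: numeral_2_eq_2 card_le_Suc_iff)
    have ne: "p \<noteq> v" "q \<noteq> v" using pq adj_irrefl by auto
    have "V - {p, q} \<subseteq> {w \<in> V. E p w \<and> E q w}"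
    proof
      fix w assume "w \<in> V - {p, q}"
      then show "w \<in> {w \<in> V. E p w \<and> E q w}"
        using complete[of p w] complete[of q w] pq ne adj_sym[of v p] adj_sym[of v q] by (cases "w = v") auto
    qed
    then have "card (V - {p, q}) \<le> card {w \<in> V. E p w \<and> E q w}"
      using 0 by (intro card_mono) auto
    moreover have "card (V - {p, q}) = k" using 0 pq by (simp add: card_Diff_subset)
    moreover have "card {w \<in> V. E p w \<and> E q w} < k"
      using card_common_neighbours[OF 0(1,3) pq(1,2)] complete[of p q] pq ne by auto
    ultimately show False by simp
  qed
next
  case (Suc n)
  then have "V \<noteq> {}" by auto
  then obtain v where v: "v \<in> V" "degree_in E V v \<le> k" using ex_degree_le[of V k] Suc.prems by blast
  then have "arc_count E (V - {v}) (V - {v}) + k * (k + 1) + 2 \<le> 2 * k * (k + 2 + n)"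
    using Suc.prems locally_sparse_subset[of V k "V - {v}"] by (intro Suc.IH) auto
  then show ?case using arc_count_remove[OF Suc.prems(1) v(1)] v(2) by simp
qed

lemma arc_count_complete_between:
  assumes "finite V" "U \<subseteq> V" "complete_between E V U"
  shows "arc_count E V V = 2 * card U * (card V - card U)"
proof -
  have fin: "finite U" "finite (V - U)" using assms finite_subset by auto
  have zero: "arc_count E U U = 0" "arc_count E (V - U) (V - U) = 0"
    using assms unfolding arc_count_def degree_in_def complete_between_def
    by (intro sum.neutral ballI card_eq_0_iff[THEN iffD2] disjI1; blast)+
  have "degree_in E (V - U) u = card (V - U)" if "u \<in> U" for u
    using that assms unfolding degree_in_def complete_between_def
    by (intro arg_cong[where f = card]) (auto simp: subset_iff)
  then have "arc_count E U (V - U) = card U * card (V - U)" by (simp add: arc_count_def)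
  moreover have "V = U \<union> (V - U)" using assms by auto
  ultimately show ?thesis
    using arc_count_Un[of U "V - U"] fin zero assms by (simp add: card_Diff_subset)
qed

section \<open>Vertices of large degree induce a forest\<close>

text \<open>
  A set in which every vertex has two neighbours plays the role of Mader's cycle. Among the separations
  of its edges choose \<open>(A, S, B)\<close>, for the edge \<open>xy\<close>, with the smallest side \<open>A\<close>, and uncross it with a
  separation \<open>(A', S', B')\<close> for a second edge \<open>xz\<close> at \<open>x\<close>.
\<close>

lemma Mader_cycle:
  assumes fin: "finite V"
    and conn: "\<And>A S. A \<subseteq> V \<Longrightarrow> S \<subseteq> V \<Longrightarrow> A \<inter> S = {} \<Longrightarrow> A \<noteq> {} \<Longrightarrow> V - A - S \<noteq> {} \<Longrightarrow>
      (\<And>u w. u \<in> A \<Longrightarrow> w \<in> V - A - S \<Longrightarrow> \<not> E u w) \<Longrightarrow> k \<le> card S"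
    and sparse: "locally_sparse k E V"
    and M: "M \<subseteq> V" "M \<noteq> {}" "\<And>v. v \<in> M \<Longrightarrow> k < degree_in E V v"
  shows "\<exists>v\<in>M. degree_in E M v \<le> 1"
proof (rule ccontr)
  assume "\<not> ?thesis"
  then have two: "2 \<le> card {u \<in> M. E v u}" if "v \<in> M" for v
    using that by (auto simp: degree_in_def not_le)
  have ex2: "\<exists>z\<in>M. E v z \<and> z \<noteq> y" if "v \<in> M" for v y
  proof (rule ccontr)
    assume "\<not> ?thesis"
    then have "{u \<in> M. E v u} \<subseteq> {y}" by auto
    then show False using two[OF that] card_mono[of "{y}" "{u \<in> M. E v u}"] by simp
  qed
  define P where "P = (\<lambda>(x, y, A, S, B). x \<in> M \<and> y \<in> M \<and> E x y \<and> separates E V A S B x y \<and> card S < k)"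
  define size_of where "size_of = (\<lambda>(x :: 'a, y :: 'a, A :: 'a set, S :: 'a set, B :: 'a set). card A)"
  obtain x0 y0 where xy0: "x0 \<in> M" "y0 \<in> M" "E x0 y0" using M(2) ex2 by blast
  then obtain A0 S0 B0 where "separates E V A0 S0 B0 x0 y0" "card S0 < k"
    using sparse M(1) unfolding locally_sparse_def by (meson subsetD)
  then have "P (x0, y0, A0, S0, B0)" using xy0 by (simp add: P_def)
  then obtain t where t: "P t" "\<And>t'. P t' \<Longrightarrow> size_of t \<le> size_of t'"
    using ex_has_least_nat[of P "(x0, y0, A0, S0, B0)" size_of] by blast
  obtain x y A S B where t_eq: "t = (x, y, A, S, B)" by (cases t)
  have xy: "x \<in> M" "y \<in> M" "E x y" and sep: "separates E V A S B x y" and cS: "card S < k"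
    using t(1) by (auto simp: P_def t_eq)
  have minimal: "card A \<le> card A'"
    if "x' \<in> M" "y' \<in> M" "E x' y'" "separates E V A' S' B' x' y'" "card S' < k" for x' y' A' S' B'
    using t(2)[of "(x', y', A', S', B')"] that by (simp add: P_def t_eq size_of_def)
  obtain z where z: "z \<in> M" "E x z" "z \<noteq> y" using ex2[OF xy(1)] by blast
  then obtain A' S' B' where sep': "separates E V A' S' B' x z" and cS': "card S' < k"
    using sparse M(1) xy(1) unfolding locally_sparse_def by (meson subsetD)
  have V: "A \<union> S \<union> B = V" "A \<inter> S = {}" "A \<inter> B = {}" "S \<inter> B = {}" "x \<in> A" "y \<in> B"
    and only: "\<And>u w. u \<in> A \<Longrightarrow> w \<in> B \<Longrightarrow> E u w \<Longrightarrow> u = x \<and> w = y"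
    using sep unfolding separates_def by blast+
  have V': "A' \<union> S' \<union> B' = V" "A' \<inter> S' = {}" "A' \<inter> B' = {}" "S' \<inter> B' = {}" "x \<in> A'" "z \<in> B'"
    and only': "\<And>u w. u \<in> A' \<Longrightarrow> w \<in> B' \<Longrightarrow> E u w \<Longrightarrow> u = x \<and> w = z"
    using sep' unfolding separates_def by blast+
  have sub: "A \<subseteq> V" "S \<subseteq> V" "B \<subseteq> V" using V(1) by auto
  have xV: "x \<in> V" "x \<notin> S" "x \<notin> B" "x \<notin> S'" "x \<notin> B'" "y \<in> V" "y \<notin> A" "y \<notin> S" "z \<in> V" "z \<notin> A'" "z \<notin> S'"
    using V V' by auto
  have yB': "y \<notin> B'" using only'[OF V'(5) _ xy(3)] z(3) by blast
  have zB: "z \<notin> B" using only[OF V(5) _ z(2)] z(3) by blast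
  have fins: "finite A" "finite S" "finite B" "finite A'" "finite S'" "finite B'"
    using fin V(1) V'(1) by (metis finite_Un)+
  \<comment> \<open>\<open>a\<close>, \<open>b\<close>, \<open>c\<close> split \<open>S\<close>
    along the second separation and \<open>d\<close>, \<open>b\<close>, \<open>e\<close> split
    \<open>S'\<close> along the first. The boundary of a corner consists of the centre
    \<open>b\<close> and two arms; the boundaries of opposite corners add up to
    \<open>card S + card S'\<close>.\<close>
  define a b c d e where "a = card (S \<inter> A')" and "b = card (S \<inter> S')" and "c = card (S \<inter> B')"
    and "d = card (A \<inter> S')" and "e = card (B \<inter> S')"
  have S_eq: "S = (S \<inter> A') \<union> (S \<inter> S') \<union> (S \<inter> B')" and S'_eq: "S' = (A \<inter> S') \<union> (S \<inter> S') \<union> (B \<inter> S')"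
    using V(1) V'(1) by blast+
  have cardS: "card S = a + b + c"
    unfolding a_def b_def c_def
    by (subst S_eq, subst card_Un_disjoint, use fins V' in blast, use fins in blast, use V' in blast,
        subst card_Un_disjoint) (use fins V' in auto)
  have cardS': "card S' = d + b + e"
    unfolding d_def b_def e_def
    by (subst S'_eq, subst card_Un_disjoint, use fins V in blast, use fins in blast, use V in blast,
        subst card_Un_disjoint) (use fins V in auto)
  show False
  proof (cases "A \<inter> B' = {}")
    case False
    let ?T = "(S \<inter> B') \<union> (S \<inter> S') \<union> (A \<inter> S')"
    let ?R = "V - (A \<inter> B') - ?T"
    have cT: "card ?T \<le> c + b + d"
      using card_Un3_le unfolding b_def c_def d_def by auto
    \<comment> \<open>Past \<open>?T\<close> the corner \<open>A \<inter> B'\<close> can only be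
      left along \<open>zx\<close>. If \<open>z\<close> lies in it, fewer than \<open>k\<close>
      vertices in \<open>?T\<close> would give a separation of \<open>zx\<close> with a smaller side
      than \<open>A\<close>; otherwise \<open>?T\<close> separates the corner outright.\<close>
    have cross: "u = z \<and> w = x" if "u \<in> A \<inter> B'" "w \<in> ?R" "E u w" for u w
    proof -
      consider "w \<in> A'" | "w \<in> B" using \<open>w \<in> ?R\<close> that(1) V(1) V'(1) by blast
      then show ?thesis
      proof cases
        case 1
        then show ?thesis using only'[of w u] adj_sym[OF that(3)] that(1) by blast
      next
        case 2
        then have "u = x" using only[of u w] that by blast
        then show ?thesis using that(1) V'(3,5) by blast
      qed
    qed
    have "k \<le> card ?T"
    proof (cases "z \<in> A")
      case True
      have sepz: "separates E V (A \<inter> B') ?T ?R z x"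
      proof (rule separates_Diff)
        show "A \<inter> B' \<inter> ?T = {}" using V(2) V'(4) by auto
        show "x \<in> ?R" using xV by auto
      qed (use sub True V'(6) cross in auto)
      have smaller: "card (A \<inter> B') < card A"
        using fins(1) V(5) xV(5) by (intro psubset_card_mono) auto
      show ?thesis
      proof (rule ccontr)
        assume "\<not> k \<le> card ?T"
        then have "card A \<le> card (A \<inter> B')"
          using minimal[OF z(1) xy(1) adj_sym[OF z(2)] sepz] by linarith
        then show False using smaller by simp
      qed
    next
      case zA: False
      show ?thesis
      proof (rule conn[of "A \<inter> B'"])
        show "A \<inter> B' \<inter> ?T = {}" using V(2) V'(4) by auto
        show "?R \<noteq> {}" using xV by auto
        show "\<not> E u w" if "u \<in> A \<inter> B'" "w \<in> ?R" for u w using cross[OF that] that zA by blast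
      qed (use sub False in auto)
    qed
    then have big: "k \<le> c + b + d" using cT by simp
    \<comment> \<open>Otherwise the boundary of this corner also needs \<open>k\<close> vertices,
      once \<open>x\<close> is added because \<open>y\<close> may lie in the corner. Both boundaries
      together have at most \<open>card S + card S' + 1 < 2 * k\<close> vertices.\<close>
    have "B \<inter> A' = {}"
    proof (rule ccontr)
      assume ne: "B \<inter> A' \<noteq> {}"
      let ?T = "(S \<inter> A') \<union> (S \<inter> S') \<union> (B \<inter> S') \<union> {x}"
      let ?R = "V - (B \<inter> A') - ?T"
      have "k \<le> card ?T"
      proof (rule conn[of "B \<inter> A'"])
        show "B \<inter> A' \<inter> ?T = {}" using V(4) V'(2) xV(3) by auto
        obtain q where "q \<in> A" "q \<in> B'" using False by auto
        then have "q \<in> ?R" using V(2,3) V'(3,4) xV(5) sub(1) by auto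
        then show "?R \<noteq> {}" by blast
        show "\<not> E u w" if "u \<in> B \<inter> A'" "w \<in> ?R" for u w
        proof
          assume uw: "E u w"
          consider "w \<in> A" | "w \<in> B'" using \<open>w \<in> ?R\<close> that(1) V(1) V'(1) by blast
          then show False
          proof cases
            case 1
            then show False using only[OF _ _ adj_sym[OF uw]] that by blast
          next
            case 2
            then show False using only'[of u w] uw that xV(3) by blast
          qed
        qed
      qed (use sub ne xV(1) in auto)
      also have "card ?T \<le> card (S \<inter> A' \<union> S \<inter> S' \<union> B \<inter> S') + 1"
        using card_Un_le[of "S \<inter> A' \<union> S \<inter> S' \<union> B \<inter> S'" "{x}"] by simp
      also have "\<dots> \<le> a + b + e + 1" using card_Un3_le unfolding a_def b_def e_def by auto
      finally show False using big cardS cardS' cS cS' by linarith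
    qed
    \<comment> \<open>Minimality of \<open>A\<close> against \<open>A'\<close> now yields
      \<open>d \<le> a\<close>, while \<open>big\<close> and \<open>card S < k\<close> yield
      \<open>a < d\<close>.\<close>
    then have "card A' \<le> card (A \<inter> A') + a"
    proof -
      assume "B \<inter> A' = {}"
      then have "A' = (A \<inter> A') \<union> (S \<inter> A')" using V(1) V'(1) by blast
      then show ?thesis using card_Un_le[of "A \<inter> A'" "S \<inter> A'"] by (simp add: a_def)
    qed
    moreover have "card (A \<inter> A') + d \<le> card A"
    proof -
      have "card (A \<inter> A') + d = card ((A \<inter> A') \<union> (A \<inter> S'))"
        unfolding d_def using fins V' by (intro card_Un_disjoint[symmetric]) auto
      also have "\<dots> \<le> card A" using fins by (intro card_mono) auto
      finally show ?thesis .
    qed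
    moreover have "card A \<le> card A'" using minimal[OF xy(1) z(1,2) sep' cS'] .
    ultimately show False using big cardS cS by linarith
  next
    case True
    let ?T = "(S \<inter> A') \<union> (S \<inter> S') \<union> (A \<inter> S')"
    have cT: "card ?T \<le> a + b + d"
      using card_Un3_le unfolding a_def b_def d_def by auto
    have nbr: "w \<in> A \<inter> A' \<or> w \<in> ?T \<or> u = x \<and> (w = y \<or> w = z)" if "u \<in> A \<inter> A'" "w \<in> V" "E u w" for u w
    proof -
      have "w \<in> A \<union> S \<union> B" "w \<in> A' \<union> S' \<union> B'" using that(2) V(1) V'(1) by simp_all
      then consider "w \<in> B" | "w \<in> B'" | "w \<in> A \<union> S" "w \<in> A' \<union> S'" by auto
      then show ?thesis
      proof cases
        case 1
        then show ?thesis using only[OF _ _ that(3)] that(1) by simp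
      next
        case 2
        then show ?thesis using only'[OF _ _ that(3)] that(1) by simp
      next
        case 3
        then show ?thesis by auto
      qed
    qed
    \<comment> \<open>Only \<open>x\<close> has edges leaving the corner
      \<open>A \<inter> A'\<close> past \<open>?T\<close>, at most to \<open>y\<close> and
      \<open>z\<close>. If the corner is \<open>{x}\<close>, the degree of \<open>x\<close> gives
      the bound; otherwise \<open>x\<close> and \<open>?T\<close> separate the rest of the
      corner.\<close>
    have big: "k \<le> a + b + d + 1"
    proof (cases "A \<inter> A' = {x}")
      case x: True
      have "{w \<in> V. E x w} \<subseteq> ?T \<union> {y, z}"
        
      proof
        fix w assume w: "w \<in> {w \<in> V. E x w}"
        then have "w \<notin> A \<inter> A'" using x adj_irrefl by auto
        then show "w \<in> ?T \<union> {y, z}" using nbr[of x w] w V(5) V'(5) by auto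
      qed
      then have "card {w \<in> V. E x w} \<le> card (?T \<union> {y, z})"
        using fins by (intro card_mono) auto
      also have "\<dots> \<le> card ?T + card {y, z}" by (rule card_Un_le)
      also have "\<dots> \<le> a + b + d + 2" using cT z(3) by simp
      finally show ?thesis using M(3)[OF xy(1)] by (simp add: degree_in_def)
    next
      case x: False
      let ?X = "A \<inter> A' - {x}"
      have "k \<le> card (insert x ?T)"
      proof (rule conn[of ?X])
        show "?X \<inter> insert x ?T = {}" using V(2) V'(2) by auto
        show "\<not> E u w" if "u \<in> ?X" "w \<in> V - ?X - insert x ?T" for u w
          
        proof
          assume "E u w"
          then show False using nbr[of u w] that by auto
        qed
        show "V - ?X - insert x ?T \<noteq> {}" using xV V(5) by auto
        show "?X \<noteq> {}" using x V(5) V'(5) by auto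
      qed (use sub xV(1) in auto)
      also have "\<dots> \<le> card ?T + 1" using card_insert_if[of ?T x] fins by simp
      finally show ?thesis using cT by simp
    qed
    let ?T' = "(S \<inter> B') \<union> (S \<inter> S') \<union> (B \<inter> S')"
    have "card ?T' \<le> c + b + e"
      using card_Un3_le unfolding b_def c_def e_def by auto
    then have small: "card ?T' < k" using big cardS cardS' cS cS' by linarith
    have "B \<inter> B' = {}"
    proof (rule ccontr)
      assume ne: "B \<inter> B' \<noteq> {}"
      let ?R = "V - (B \<inter> B') - ?T'"
      have "k \<le> card ?T'"
      proof (rule conn[of "B \<inter> B'"])
        show "B \<inter> B' \<inter> ?T' = {}" using V(4) V'(4) by auto
        show "?R \<noteq> {}" using xV by auto
        show "\<not> E u w" if "u \<in> B \<inter> B'" "w \<in> ?R" for u w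
        proof
          assume uw: "E u w"
          have "w \<in> A \<union> S \<union> B" "w \<in> A' \<union> S' \<union> B'" using that(2) V(1) V'(1) by simp_all
          moreover note \<open>w \<in> ?R\<close> that(1)
          ultimately consider "w \<in> A" | "w \<in> A'" by auto
          then show False
          proof cases
            case 1
            then show False using only[OF _ _ adj_sym[OF uw]] that yB' by blast
          next
            case 2
            then show False using only'[OF _ _ adj_sym[OF uw]] that zB by blast
          qed
        qed
      qed (use sub ne in auto)
      then show False using small by simp
    qed
    \<comment> \<open>Minimality of \<open>A\<close> against \<open>B'\<close>, the side of
      \<open>z\<close> for the reversed edge \<open>zx\<close>, gives \<open>d + 1 \<le> c\<close>,
      and then \<open>big\<close> contradicts \<open>card S < k\<close>.\<close>
    then have "B' = S \<inter> B'" using True V(1) V'(1) by blast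
    then have "card B' = c" by (simp add: c_def)
    moreover have "card A \<le> card B'"
      using minimal[OF z(1) xy(1) adj_sym[OF z(2)] separates_commute[OF sep'] cS'] .
    moreover have "d + 1 \<le> card A"
    proof -
      have "d + 1 = card (insert x (A \<inter> S'))"
        unfolding d_def using fins V' by (subst card_insert_disjoint) auto
      also have "\<dots> \<le> card A" using fins V by (intro card_mono) auto
      finally show ?thesis .
    qed
    ultimately show False using big cardS cS by linarith
  qed
qed

text \<open>Acyclicity enters in the form that \<open>Mader_cycle\<close> supplies: removing
  vertices of degree at most one, down to a single vertex, takes at most one edge each.\<close>

lemma arc_count_forest:
  assumes "finite M" "M \<noteq> {}" "\<And>W. W \<subseteq> M \<Longrightarrow> W \<noteq> {} \<Longrightarrow> \<exists>v\<in>W. degree_in E W v \<le> 1"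
  shows "arc_count E M M + 2 \<le> 2 * card M"
  using assms
proof (induction "card M" arbitrary: M)
  case 0
  then show ?case by simp
next
  case (Suc n)
  then obtain v where v: "v \<in> M" "degree_in E M v \<le> 1" by blast
  show ?case
  proof (cases "M = {v}")
    case True
    then show ?thesis using adj_irrefl by (simp add: arc_count_def degree_in_singleton)
  next
    case False
    have "arc_count E (M - {v}) (M - {v}) + 2 \<le> 2 * card (M - {v})"
    proof (rule Suc.hyps(1))
      show "n = card (M - {v})" using Suc.hyps(2) Suc.prems(1) v by simp
      show "M - {v} \<noteq> {}" using False v by blast
      show "\<exists>u\<in>W. degree_in E W u \<le> 1" if "W \<subseteq> M - {v}" "W \<noteq> {}" for W
        using Suc.prems(3)[of W] that by blast
    qed (use Suc.prems in simp)
    then show ?thesis using arc_count_remove[OF Suc.prems(1) v(1)] v Suc.prems(1) Suc.hyps(2) by simp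
  qed
qed

section \<open>The extremal graphs\<close>

text \<open>Every edge has an end in \<open>L\<close>, where degrees are at most \<open>k\<close>.
  If \<open>M\<close> has fewer than \<open>k\<close> vertices, too few edges are possible;
  otherwise there are at most \<open>k * card L\<close> edges, which forces
  \<open>card M = k\<close> and equality throughout.\<close>

lemma complete_between_if_high_independent:
  assumes fin: "finite V" and n: "card V = n" "3 * k \<le> n" and k: "1 \<le> k"
    and indep: "\<And>u v. u \<in> V \<Longrightarrow> v \<in> V \<Longrightarrow> k < degree_in E V u \<Longrightarrow> k < degree_in E V v \<Longrightarrow> \<not> E u v"
    and many: "2 * k * (n - k) \<le> arc_count E V V"
  shows "\<exists>U\<subseteq>V. card U = k \<and> complete_between E V U"
proof -
  define M where "M = {v \<in> V. k < degree_in E V v}"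
  define L where "L = V - M"
  have sub: "M \<subseteq> V" "L \<subseteq> V" "V = M \<union> L" "M \<inter> L = {}" "finite M" "finite L"
    using fin by (auto simp: M_def L_def)
  define t and m where "t = card M" and "m = card L"
  have tm: "t + m = n" using sub n card_Un_disjoint[of M L] by (simp add: t_def m_def)
  have M0: "degree_in E M v = 0" if "v \<in> M" for v
  proof -
    have "{u \<in> M. E v u} = {}" using that indep by (auto simp: M_def)
    then show ?thesis unfolding degree_in_def by (simp only: card.empty)
  qed
  then have "arc_count E M M = 0" by (simp add: arc_count_def)
  then have arcV: "arc_count E V V = 2 * arc_count E L M + arc_count E L L"
    using arc_count_Un[of M L] arc_count_commute[of M L] sub by simp
  have degL: "degree_in E V w \<le> k" if "w \<in> L" for w using that by (auto simp: L_def M_def)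
  have "arc_count E L V \<le> m * k"
    unfolding arc_count_def m_def using sum_bounded_above[of L "degree_in E V" k, OF degL] by simp
  then have Lk: "arc_count E L M + arc_count E L L \<le> m * k"
    using arc_count_Un_right[of M L E L] sub by simp
  have LM: "arc_count E L M \<le> m * t" using arc_count_le[of M E L] sub by (simp add: m_def t_def)
  show ?thesis
  proof (cases "t < k")
    case True
    then obtain d where d: "k = t + d" "d \<ge> 1" using less_imp_add_positive[of t k] by (auto simp: Suc_le_eq)
    obtain r where r: "n = 3 * k + r" using n(2) le_Suc_ex by blast
    have m_eq: "m = 2 * k + r + d" using tm r d by simp
    have "arc_count E V V \<le> m * t + m * k" using arcV Lk LM by linarith
    also have "m * t + m * k < 2 * k * (2 * k + r)"
      unfolding m_eq d(1) using d(2) by (auto simp: algebra_simps)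
    finally show ?thesis using many r by (simp add: algebra_simps)
  next
    case False
    then obtain j where j: "t = k + j" using le_Suc_ex not_less by blast
    have nk: "n - k = m + j" using tm j by simp
    have "2 * k * (m + j) \<le> arc_count E V V" using many nk by simp
    then have "2 * k * (m + j) \<le> 2 * (m * k)" using arcV Lk by linarith
    then have "j = 0" using k by (simp add: algebra_simps)
    then have tk: "t = k" using j by simp
    have "2 * (m * k) \<le> 2 * arc_count E L M + arc_count E L L"
      using many nk \<open>j = 0\<close> arcV by (simp add: algebra_simps)
    then have full: "arc_count E L L = 0" "arc_count E L M = m * k" using Lk by linarith+
    have L0: "\<not> E u v" if "u \<in> L" "v \<in> L" for u v
      using full(1) that sub(6) unfolding arc_count_def degree_in_def by auto
    have "degree_in E M v = k" if "v \<in> L" for v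
    proof (rule ccontr)
      assume "degree_in E M v \<noteq> k"
      moreover have le: "degree_in E M w \<le> k" for w
        using degree_in_le_card[of M E w] sub(5) tk by (simp add: t_def)
      ultimately have "degree_in E M v < k" by (simp add: le_neq_implies_less)
      then have "arc_count E L M < (\<Sum>w\<in>L. k)"
        unfolding arc_count_def using le that sub(6) by (intro sum_strict_mono_ex1) auto
      then show False using full(2) by (simp add: m_def)
    qed
    then have LMadj: "E v u" if "v \<in> L" "u \<in> M" for u v
      using that card_subset_eq[of M "{u \<in> M. E v u}"] sub(5) tk by (auto simp: degree_in_def t_def)
    have MMadj: "\<not> E u v" if "u \<in> M" "v \<in> M" for u v
      using M0[OF that(1)] that(2) sub(5) by (auto simp: degree_in_def)
    have "complete_between E V M"
      unfolding complete_between_def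
    proof (intro ballI)
      fix u v assume uv: "u \<in> V" "v \<in> V"
      show "E u v \<longleftrightarrow> (u \<in> M) \<noteq> (v \<in> M)"
      proof (cases "u \<in> M")
        case True
        then show ?thesis using uv MMadj[of u v] LMadj[of v u] adj_sym[of v u] by (auto simp: L_def)
      next
        case False
        then show ?thesis using uv L0[of u v] LMadj[of u v] by (auto simp: L_def)
      qed
    qed
    then show ?thesis using sub(1) tk t_def by blast
  qed
qed

text \<open>An edge inside \<open>M\<close> is refuted separately for \<open>card M\<close> below,
  equal to and above \<open>k\<close>. Counting disposes of all cases except
  \<open>card M = k + 1\<close>, which needs a structural argument.\<close>

lemma complete_between_if_high_forest:
  assumes fin: "finite V" and sparse: "locally_sparse k E V" and k: "2 \<le> k"
    and n: "card V = n" "k * (k + 5) \<le> 2 * n"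
    and forest: "{v \<in> V. k < degree_in E V v} \<noteq> {} \<Longrightarrow>
      arc_count E {v \<in> V. k < degree_in E V v} {v \<in> V. k < degree_in E V v} + 2
        \<le> 2 * card {v \<in> V. k < degree_in E V v}"
    and many: "2 * k * (n - k) \<le> arc_count E V V"
  shows "\<exists>U\<subseteq>V. card U = k \<and> complete_between E V U"
proof (cases "\<exists>u\<in>V. \<exists>v\<in>V. k < degree_in E V u \<and> k < degree_in E V v \<and> E u v")
  case False
  obtain c where c: "k = c + 2" using k by (metis add.commute le_Suc_ex)
  have "3 * k \<le> n" using n(2) by (simp add: c algebra_simps)
  then show ?thesis using complete_between_if_high_independent[OF fin n(1) _ _ _ many] k False by auto
next
  case True
  define M where "M = {v \<in> V. k < degree_in E V v}"
  define L where "L = V - M"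
  have sub: "M \<subseteq> V" "L \<subseteq> V" "V = M \<union> L" "M \<inter> L = {}" "finite M" "finite L"
    using fin by (auto simp: M_def L_def)
  obtain x y where xy: "x \<in> M" "y \<in> M" "E x y" using True by (auto simp: M_def)
  have xny: "x \<noteq> y" using xy(3) adj_irrefl by metis
  define t and m where "t = card M" and "m = card L"
  have tm: "t + m = n" using sub n card_Un_disjoint[of M L] by (simp add: t_def m_def)
  have MM: "arc_count E M M + 2 \<le> 2 * t" using forest xy(1) by (auto simp: M_def t_def)
  have arcV: "arc_count E V V = arc_count E M M + 2 * arc_count E L M + arc_count E L L"
    using arc_count_Un[of M L] arc_count_commute[of M L] sub by simp
  have degL: "degree_in E V w \<le> k" if "w \<in> L" for w using that by (auto simp: L_def M_def)
  have "arc_count E L V \<le> m * k"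
    unfolding arc_count_def m_def using sum_bounded_above[of L "degree_in E V" k, OF degL] by simp
  then have Lk: "arc_count E L M + arc_count E L L \<le> m * k"
    using arc_count_Un_right[of M L E L] sub by simp
  have LM: "arc_count E L M \<le> m * t" using arc_count_le[of M E L] sub by (simp add: m_def t_def)
  have LM_sum: "arc_count E L M = (\<Sum>p\<in>M. degree_in E L p)"
    using arc_count_commute[of L M] sub by (simp add: arc_count_def)
  \<comment> \<open>Adjacent \<open>p\<close> and \<open>q\<close> share fewer than \<open>k\<close>
    neighbours, so between them they miss many vertices of \<open>L\<close>.\<close>
  have edge_bound: "degree_in E L p + degree_in E L q + 1 \<le> m + k" if "p \<in> M" "q \<in> M" "E p q" for p q
  proof -
    have "degree_in E L p + degree_in E L q
        = card ({u \<in> L. E p u} \<union> {u \<in> L. E q u}) + card ({u \<in> L. E p u} \<inter> {u \<in> L. E q u})"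
      unfolding degree_in_def using sub(6) by (intro card_Un_Int) auto
    moreover have "card ({u \<in> L. E p u} \<union> {u \<in> L. E q u}) \<le> m"
      unfolding m_def using sub(6) by (intro card_mono) auto
    moreover have "card ({u \<in> L. E p u} \<inter> {u \<in> L. E q u}) \<le> card {u \<in> V. E p u \<and> E q u}"
      using fin sub by (intro card_mono) auto
    moreover have "card {u \<in> V. E p u \<and> E q u} < k"
      using card_common_neighbours[OF fin sparse] that sub(1) by auto
    ultimately show ?thesis by linarith
  qed
  have rest: "(\<Sum>p\<in>M - {p1} - {p2}. degree_in E L p) \<le> (t - 2) * m" if "p1 \<in> M" "p2 \<in> M" "p1 \<noteq> p2" for p1 p2
    using sum_bounded_above[of "M - {p1} - {p2}" "degree_in E L" m] degree_in_le_card[OF sub(6), of E]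
      that sub(5) by (simp add: t_def m_def numeral_2_eq_2)
  \<comment> \<open>Linear consequences of the quadratic lower bound on \<open>n\<close>.\<close>
  have n4: "10 * k \<le> 2 * n + 8" "k \<le> n" "8 * k \<le> 2 * n + 4"
  proof -
    obtain c where c: "k = c + 2" using k by (metis add.commute le_Suc_ex)
    define s where "s = c * c"
    have "s + 9 * c + 14 \<le> 2 * n" using n(2) by (simp add: c s_def algebra_simps)
    moreover have "c \<le> s" unfolding s_def by (rule le_square)
    ultimately show "10 * k \<le> 2 * n + 8" "k \<le> n" "8 * k \<le> 2 * n + 4"
      unfolding c by simp_all
  qed
  consider "t < k" | "t = k" | "t > k" by linarith
  then show ?thesis
  proof cases
    case 1
    then obtain d where d: "k = t + d" "d \<ge> 1" using less_imp_add_positive[of t k] by (auto simp: Suc_le_eq)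
    \<comment> \<open>The shortfall \<open>d\<close> of \<open>M\<close> enters multiplied by
      \<open>N\<close>, which is too large for the arcs of the forest to compensate.\<close>
    define N where "N = n - k"
    have N: "m = N + d" "4 * k \<le> N + 4" using tm d n4(1,2) unfolding N_def by linarith+
    have "arc_count E V V + 2 \<le> 2 * t + m * t + m * k" using arcV Lk LM MM by linarith
    then have "2 * k * N + 2 \<le> 2 * t + (N + d) * (t + k)" using many N by (simp add: N_def algebra_simps)
    then have "d * N + d * d + 2 \<le> 2 * t + 2 * (d * k)"
      unfolding d(1) by (simp add: algebra_simps)
    moreover have "d * (4 * k) \<le> d * (N + 4)" using N(2) by (rule mult_left_mono) simp
    moreover have "1 * k \<le> d * k" "1 * d \<le> d * d" using d(2) by (intro mult_right_mono; simp)+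
    ultimately have "2 * (d * k) + d * d + 2 \<le> 2 * k + 2 * d"
      using d(1) by (simp add: distrib_left mult.left_commute)
    moreover obtain e where "d = Suc e" using d(2) by (cases d) auto
    ultimately show ?thesis by (simp add: algebra_simps)
  next
    case 2
    \<comment> \<open>The edge \<open>xy\<close> costs at least \<open>m - k + 1\<close> of the
      \<open>m * k\<close> possible arcs from \<open>L\<close> to \<open>M\<close>. The forest
      returns at most \<open>2 * k - 2\<close> arcs, which is less because \<open>n4\<close> makes
      \<open>m\<close> at least \<open>3 * k - 2\<close>.\<close>
    have "arc_count E L M = degree_in E L x + (degree_in E L y + (\<Sum>p\<in>M - {x} - {y}. degree_in E L p))"
      unfolding LM_sum using xy xny sub(5) by (auto simp: sum.remove[of M x] sum.remove[of "M - {x}" y])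
    then have "arc_count E L M + 1 \<le> m + k + (k - 2) * m"
      using rest[OF xy(1,2) xny] edge_bound[OF xy] 2 by simp
    moreover obtain c where c: "k = c + 2" using k by (metis add.commute le_Suc_ex)
    moreover have "2 * (m * k) + 2 \<le> 2 * k + arc_count E L M + m * k"
    proof -
      have "2 * (m * k) \<le> arc_count E V V" using many 2 tm by (auto simp: ac_simps)
      then show ?thesis using arcV Lk MM 2 by linarith
    qed
    ultimately have "m + 3 \<le> 3 * k" by (simp add: algebra_simps)
    then show ?thesis using tm 2 n4 k by linarith
  next
    case 3
    then obtain j where j: "t = k + Suc j" by (metis add_Suc_right less_imp_Suc_add)
    have nk: "n - k = m + Suc j" using tm j by simp
    obtain c where c: "k = c + 2" using k by (metis add.commute le_Suc_ex)
    \<comment> \<open>A vertex of \<open>M\<close> beyond \<open>k + 1\<close> would raise the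
      required count by \<open>2 * k\<close> arcs but the forest by only two, so
      \<open>j = 0\<close> and all estimates are tight.\<close>
    have ineq: "2 * k * (m + Suc j) + 2 \<le> 2 * t + 2 * arc_count E L M + arc_count E L L"
      using many arcV MM unfolding nk by linarith
    then have "2 * k * (m + Suc j) + 2 \<le> 2 * t + 2 * (m * k)" using Lk by linarith
    then have "j * (c + 1) \<le> 0" using j c by (simp add: algebra_simps)
    then have "j = 0" by simp
    then have t: "t = k + 1" using j by simp
    have eqs: "arc_count E L L = 0" "arc_count E L M = m * k" "arc_count E M M = 2 * k"
    proof -
      have "2 * (m * k) + 2 * k \<le> arc_count E V V" using many nk \<open>j = 0\<close> by (simp add: algebra_simps)
      then show "arc_count E L L = 0" "arc_count E L M = m * k" "arc_count E M M = 2 * k"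
        using Lk arcV MM t by linarith+
    qed
    have m_big: "3 * k \<le> m + 2"
      using n(2) tm[symmetric] t by (simp add: c algebra_simps)
    \<comment> \<open>Each vertex of \<open>L\<close> thus misses exactly one of the
      \<open>k + 1\<close> vertices of \<open>M\<close>.\<close>
    have degM: "degree_in E M w = k" if "w \<in> L" for w
    proof (rule ccontr)
      assume "degree_in E M w \<noteq> k"
      moreover have le: "degree_in E M w \<le> k" if "w \<in> L" for w
        using le_trans[OF degree_in_mono[OF fin sub(1)] degL[OF that]] .
      ultimately have "degree_in E M w < k" using that by (simp add: le_neq_implies_less)
      then have "arc_count E L M < (\<Sum>w\<in>L. k)"
        unfolding arc_count_def using le that sub(6) by (intro sum_strict_mono_ex1) auto
      then show False using eqs(2) by (simp add: m_def)
    qed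
    have "Min (degree_in E L ` M) \<in> degree_in E L ` M" using sub(5) xy(1) by (intro Min_in) auto
    then obtain v where v: "v \<in> M" "degree_in E L v = Min (degree_in E L ` M)" by auto
    have vmin: "degree_in E L v \<le> degree_in E L p" if "p \<in> M" for p
      unfolding v(2) using that sub(5) by (intro Min_le) auto
    \<comment> \<open>Equality holds throughout the count. An edge \<open>pq\<close> inside \<open>M\<close> forces many vertices of \<open>L\<close> to
      miss \<open>p\<close> or \<open>q\<close>, although each misses only one vertex of \<open>M\<close>; so \<open>M\<close> induces a star
      whose centre \<open>v\<close> is missed most often.\<close>
    have star: "\<not> E p q" if "p \<in> M - {v}" "q \<in> M - {v}" for p q
    proof
      assume pq: "E p q"
      then have "p \<noteq> q" using adj_irrefl by auto
      then have "arc_count E L M = degree_in E L v +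
          (degree_in E L p + (degree_in E L q + (\<Sum>r\<in>M - {v} - {p} - {q}. degree_in E L r)))"
        unfolding LM_sum using v(1) that sub(5)
        by (simp add: sum.remove[of M v] sum.remove[of "M - {v}" p] sum.remove[of "M - {v} - {p}" q])
      moreover have "(\<Sum>r\<in>M - {v} - {p} - {q}. degree_in E L r) \<le> c * m"
        using sum_bounded_above[of "M - {v} - {p} - {q}" "degree_in E L" m] degree_in_le_card[OF sub(6), of E]
          that \<open>p \<noteq> q\<close> v(1) sub(5) t c by (simp add: t_def m_def)
      ultimately have "m * k \<le> degree_in E L v + degree_in E L p + degree_in E L q + c * m"
        using eqs(2) by linarith
      then have "2 * m \<le> degree_in E L v + degree_in E L p + degree_in E L q"
        by (simp add: c algebra_simps)
      then show False using vmin[of p] vmin[of q] that edge_bound[of p q] pq m_big by simp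
    qed
    have "arc_count E (M - {v}) (M - {v}) = 0"
    proof -
      have "{q \<in> M - {v}. E p q} = {}" if "p \<in> M - {v}" for p using star[OF that] by auto
      then show ?thesis unfolding arc_count_def degree_in_def by (intro sum.neutral ballI) (simp only: card.empty)
    qed
    then have degv: "degree_in E M v = k" using arc_count_remove[OF sub(5) v(1)] eqs(3) by simp
    have "{u \<in> M. E v u} = M - {v}"
      using degv t v(1) sub(5) adj_irrefl by (intro card_subset_eq) (auto simp: degree_in_def t_def)
    then have vM: "E v u" if "u \<in> M - {v}" for u using that by auto
    \<comment> \<open>The contradiction comes from a triangle \<open>v\<close>, \<open>u\<close>,
      \<open>w\<close> with \<open>w\<close> in \<open>L\<close>: the set \<open>S\<close>
      separating the edge \<open>vu\<close> must contain \<open>w\<close> and the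
      \<open>k - 1\<close> vertices of \<open>M - {v, u}\<close>, although
      \<open>card S < k\<close>.\<close>
    have "degree_in E V v = degree_in E M v + degree_in E L v"
      using degree_in_Un[of M L E v] sub by simp
    then have "degree_in E L v \<noteq> 0" using v(1) degv by (simp add: M_def)
    then have "{u \<in> L. E v u} \<noteq> {}" unfolding degree_in_def by (metis card.empty)
    then obtain w where w: "w \<in> L" "E v w" by blast
    have "\<not> {u \<in> M. E w u} \<subseteq> {v}"
    proof
      assume "{u \<in> M. E w u} \<subseteq> {v}"
      then have "card {u \<in> M. E w u} \<le> card {v}" by (intro card_mono) simp
      then show False using degM[OF w(1)] k by (simp add: degree_in_def)
    qed
    then obtain u where u: "u \<in> M - {v}" "E w u" by auto
    obtain A S B where sep: "separates E V A S B v u" and cS: "card S < k"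
      using sparse vM[OF u(1)] v(1) u(1) sub(1) unfolding locally_sparse_def by (meson DiffD1 subsetD)
    have parts: "A \<union> S \<union> B = V" "v \<in> A" "u \<in> B"
      and only: "\<And>u' w'. u' \<in> A \<Longrightarrow> w' \<in> B \<Longrightarrow> E u' w' \<Longrightarrow> u' = v \<and> w' = u"
      using sep unfolding separates_def by blast+
    have finS: "finite S" using parts(1) fin by (metis finite_Un)
    have wS: "w \<in> S"
      using common_neighbours_subset[OF sep vM[OF u(1)] _ w(2) adj_sym[OF u(2)]] w(1) sub(2) by blast
    \<comment> \<open>If \<open>S\<close> held all vertices of \<open>L\<close> that miss
      \<open>v\<close>, there would be at most \<open>k - 2\<close> of them, since \<open>w\<close>
      is in \<open>S\<close> too. Then \<open>v\<close>, and by its choice also \<open>u\<close>,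
      would have more neighbours in \<open>L\<close> than \<open>edge_bound\<close> allows.\<close>
    have "\<not> {q \<in> L. \<not> E v q} \<subseteq> S"
    proof
      assume "{q \<in> L. \<not> E v q} \<subseteq> S"
      then have "{q \<in> L. \<not> E v q} \<subseteq> S - {w}" using w(2) by auto
      then have "card {q \<in> L. \<not> E v q} \<le> card (S - {w})" using finS by (intro card_mono) auto
      also have "\<dots> = card S - 1" using wS finS by simp
      finally have "card {q \<in> L. \<not> E v q} + 1 < k" using cS wS finS k by linarith
      moreover have "card ({q \<in> L. E v q} \<union> {q \<in> L. \<not> E v q}) = degree_in E L v + card {q \<in> L. \<not> E v q}"
        unfolding degree_in_def using sub(6) by (intro card_Un_disjoint) auto
      moreover have "{q \<in> L. E v q} \<union> {q \<in> L. \<not> E v q} = L" by auto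
      ultimately have "m + 1 < degree_in E L v + k" by (simp add: m_def)
      then show False using edge_bound[OF v(1) _ vM[OF u(1)]] vmin[of u] u(1) m_big by simp
    qed
    then obtain q where q: "q \<in> L" "\<not> E v q" "q \<notin> S" by auto
    have "{p \<in> M. E q p} \<subseteq> M - {v}" using q(2) adj_sym[of q v] by auto
    then have "{p \<in> M. E q p} = M - {v}"
      using degM[OF q(1)] t v(1) sub(5) by (intro card_subset_eq) (auto simp: degree_in_def t_def)
    then have qM: "E q p" if "p \<in> M - {v}" for p using that by auto
    have qv: "q \<noteq> v" using q(1) v(1) sub(4) by auto
    have "q \<notin> A" using only[OF _ parts(3) qM[OF u(1)]] qv by blast
    then have qB: "q \<in> B" using q parts(1) sub(2) by blast
    \<comment> \<open>A vertex of \<open>M - {v, u}\<close> is adjacent to \<open>v\<close> in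
      \<open>A\<close> and to \<open>q\<close> in \<open>B\<close>, so it can lie on neither
      side.\<close>
    have "insert w (M - {v, u}) \<subseteq> S"
    proof
      fix p assume "p \<in> insert w (M - {v, u})"
      then consider "p = w" | "p \<in> M" "p \<noteq> v" "p \<noteq> u" by auto
      then show "p \<in> S"
      proof cases
        case 2
        have "p \<notin> A" using only[OF _ qB] adj_sym[OF qM[of p]] 2 by auto
        moreover have "p \<notin> B" using only[OF parts(2) _ vM[of p]] 2 by auto
        ultimately show ?thesis using 2(1) sub(1) parts(1) by auto
      qed (use wS in simp)
    qed
    then have "card (insert w (M - {v, u})) \<le> card S" using finS by (intro card_mono)
    moreover have "w \<notin> M" using w(1) sub(4) by auto
    then have "card (insert w (M - {v, u})) = k"
    proof -
      have "card (M - {v, u}) = card M - card {v, u}" using v(1) u(1) by (intro card_Diff_subset) auto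
      moreover have "card {v, u} = 2" using u(1) by auto
      ultimately show ?thesis using \<open>w \<notin> M\<close> sub(5) t k by (simp add: t_def)
    qed
    ultimately show ?thesis using cS by simp
  qed
qed

section \<open>The edge-connected case\<close>

text \<open>Deleting one end of every other cut edge turns an edge cut into a mixed separation, so
  the degeneracy bounds serve both kinds of connectivity.\<close>

lemma edge_sparse_imp_locally_sparse:
  assumes fin: "finite V" and sparse: "edge_sparse k E V"
  shows "locally_sparse k E V"
  unfolding locally_sparse_def
proof (intro ballI impI)
  fix x y assume xy: "x \<in> V" "y \<in> V" "E x y"
  then obtain A where A: "A \<subseteq> V" "x \<in> A" "y \<in> V - A" "arc_count E A (V - A) \<le> k"
    using sparse unfolding edge_sparse_def by meson
  \<comment> \<open>\<open>S\<close> consists of one end of each further cut edge, chosen different from \<open>x\<close> and \<open>y\<close>.\<close>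
  let ?C = "{(u, w). u \<in> A \<and> w \<in> V - A \<and> E u w}"
  have finC: "finite ?C"
    using fin A(1) by (intro finite_subset[of ?C "V \<times> V"]) auto
  have cC: "card ?C \<le> k" using A fin arc_count_eq_card[of A "V - A" E] by (simp add: finite_subset)
  define f where "f = (\<lambda>(u, w). if u = x then w else u)"
  define S where "S = f ` (?C - {(x, y)})"
  have "card S \<le> card (?C - {(x, y)})" unfolding S_def using finC by (intro card_image_le) auto
  also have "\<dots> < card ?C" using finC A xy by (intro psubset_card_mono) auto
  finally have cS: "card S < k" using cC by simp
  have fS: "f (u, w) \<in> S" if "u \<in> A" "w \<in> V - A" "E u w" "(u, w) \<noteq> (x, y)" for u w
    unfolding S_def using that by (intro imageI) auto
  have "x \<notin> S" "y \<notin> S" "S \<subseteq> V" using A by (auto simp: S_def f_def split: if_splits)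
  moreover have "u = x \<and> w = y" if "u \<in> A - S" "w \<in> V - A - S" "E u w" for u w
  proof (rule ccontr)
    assume "\<not> (u = x \<and> w = y)"
    then have "f (u, w) \<in> S" using fS[of u w] that by auto
    then show False using that by (auto simp: f_def split: if_splits)
  qed
  ultimately have "separates E V (A - S) S (V - A - S) x y"
    unfolding separates_def using A by auto
  then show "\<exists>A S B. separates E V A S B x y \<and> card S < k" using cS by blast
qed

text \<open>The degrees in \<open>A\<close> sum to more than \<open>k * card A\<close>. If
  \<open>A\<close> had at most \<open>k\<close> vertices, its inner arcs could absorb so little of
  this that more than \<open>k\<close> would leave \<open>A\<close>.\<close>

lemma cut_side_large:
  assumes "finite V" "A \<subseteq> V" "x \<in> A" "k < degree_in E V x" "arc_count E A (V - A) \<le> k"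
    and "\<And>v. v \<in> A \<Longrightarrow> k \<le> degree_in E V v"
  shows "k < card A"
proof (rule ccontr)
  assume small: "\<not> k < card A"
  have fin: "finite A" "finite (V - A)" using assms finite_subset by auto
  have "(\<Sum>v\<in>A. k) < (\<Sum>v\<in>A. degree_in E V v)"
    using assms fin by (intro sum_strict_mono_ex1) auto
  then have "card A * k < arc_count E A A + arc_count E A (V - A)"
    using arc_count_Un_right[of A "V - A" E A] fin assms(2)
    by (simp add: arc_count_def Un_absorb1 Un_Diff_cancel)
  moreover have "arc_count E A A \<le> card A * (card A - 1)" using arc_count_le_complete[OF fin(1)] .
  moreover obtain a where a: "card A = Suc a" using assms(3) fin(1) by (metis card_Suc_Diff1)
  moreover have "Suc a * a \<le> k * a" using small a by (intro mult_right_mono) auto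
  ultimately show False using assms(5) by (simp add: algebra_simps)
qed

text \<open>An edge between vertices of degree above \<open>k\<close> yields a cut with at most
  \<open>k\<close> edges and more than \<open>k\<close> vertices on each side. The degeneracy bound
  on each side then leaves too few edges in total.\<close>

lemma complete_between_if_edge_sparse_min_degree:
  assumes fin: "finite V" and n: "card V = n" "3 * k \<le> n" and k: "2 \<le> k"
    and sparse: "edge_sparse k E V" and mindeg: "\<And>v. v \<in> V \<Longrightarrow> k \<le> degree_in E V v"
    and many: "2 * k * (n - k) \<le> arc_count E V V"
    and many': "2 * k * (n - k) + k * (k + 5) \<le> arc_count E V V + 2 * n"
  shows "\<exists>U\<subseteq>V. card U = k \<and> complete_between E V U"
proof (cases "\<exists>u\<in>V. \<exists>v\<in>V. k < degree_in E V u \<and> k < degree_in E V v \<and> E u v")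
  case False
  then show ?thesis using complete_between_if_high_independent[OF fin n(1,2) _ _ many] k by auto
next
  case True
  then obtain x y where xy: "x \<in> V" "y \<in> V" "k < degree_in E V x" "k < degree_in E V y" "E x y" by auto
  then obtain A where A: "A \<subseteq> V" "x \<in> A" "y \<in> V - A" and cut: "arc_count E A (V - A) \<le> k"
    using sparse unfolding edge_sparse_def by meson
  define B where "B = V - A"
  have B: "B \<subseteq> V" "V = A \<union> B" "A \<inter> B = {}" "finite A" "finite B" "V - B = A"
    using A(1) fin finite_subset by (auto simp: B_def)
  have kA: "k < card A" using cut_side_large[OF fin A(1,2) xy(3) cut] mindeg A(1) by auto
  have cut': "arc_count E B (V - B) \<le> k"
    using cut arc_count_commute[of A B] B(4-6) unfolding B_def[symmetric] by simp
  have kB: "k < card B" using cut_side_large[OF fin B(1) _ xy(4) cut'] mindeg A(3) B(1) by (auto simp: B_def)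
  have ls: "locally_sparse k E A" "locally_sparse k E B"
    using edge_sparse_imp_locally_sparse[OF B(4) edge_sparse_subset[OF fin sparse A(1)]]
      edge_sparse_imp_locally_sparse[OF B(5) edge_sparse_subset[OF fin sparse B(1)]] .
  obtain a where a: "card A = k + a" using kA less_imp_add_positive by metis
  obtain b where b: "card B = k + b" using kB less_imp_add_positive by metis
  have nab: "n = 2 * k + a + b" using card_Un_disjoint[of A B] B n(1) a b by simp
  have A_le: "arc_count E A A + k * (k + 1) \<le> 2 * k * (k + a)"
    using arc_count_le_degenerate[OF B(4) a ls(1)] .
  have B_le: "arc_count E B B + k * (k + 1) \<le> 2 * k * (k + b)"
    using arc_count_le_degenerate[OF B(5) b ls(2)] .
  have "arc_count E V V = arc_count E A A + 2 * arc_count E A B + arc_count E B B"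
    using arc_count_Un[of A B] B by simp
  then have arcV: "arc_count E V V \<le> arc_count E A A + 2 * k + arc_count E B B"
    using cut by (simp add: B_def)
  then have many2: "2 * k * (k + a + b) \<le> arc_count E A A + 2 * k + arc_count E B B"
  proof -
    have "n - k = k + a + b" using nab by simp
    then show ?thesis using many arcV by simp
  qed
  \<comment> \<open>The plain bounds for both sides plus the cut give exactly
    \<open>2 * k * (n - k)\<close> arcs, so one more edge has to be saved. \<open>many'\<close>
    makes \<open>n\<close> large enough for one side to have \<open>k + 2\<close> vertices, where
    the improved bound applies.\<close>
  have strict: "arc_count E A A + k * (k + 1) + (arc_count E B B + k * (k + 1)) + 2
      \<le> 2 * k * (k + a) + 2 * k * (k + b)"
  proof -
    obtain c where "k = c + 2" using k by (metis add.commute le_Suc_ex)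
    moreover have "k * (k + 5) \<le> 2 * n"
      using many' arcV A_le B_le nab by (simp add: algebra_simps)
    ultimately have "a + b \<ge> 3" using nab by (simp add: algebra_simps)
    then consider "a \<ge> 2" | "b \<ge> 2" by linarith
    then show ?thesis
    proof cases
      case 1
      then obtain r where "a = 2 + r" using le_Suc_ex by blast
      then show ?thesis using arc_count_less_degenerate[OF B(4) _ ls(1) k, of r] a B_le by (simp add: algebra_simps)
    next
      case 2
      then obtain r where "b = 2 + r" using le_Suc_ex by blast
      then show ?thesis using arc_count_less_degenerate[OF B(5) _ ls(2) k, of r] b A_le by (simp add: algebra_simps)
    qed
  qed
  show ?thesis using many2 strict by (simp add: algebra_simps)
qed

text \<open>
  Removing a vertex of degree less than \<open>k\<close> raises \<open>e(V) - k(|V| - k)\<close> by at least 1. As this excess is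
  at most \<open>k(k-1)/2\<close> by degeneracy, the last hypothesis (half of it, in terms of edges) excludes that
  such removals lead down to fewer than \<open>3k\<close> vertices.
\<close>

lemma complete_between_if_edge_sparse:
  assumes "finite V" "card V = 3 * k + i" "2 \<le> k" "edge_sparse k E V"
    and "2 * k * (2 * k + i) \<le> arc_count E V V"
    and "2 * k * (2 * k + i) + k * (k + 5) \<le> arc_count E V V + 2 * (3 * k + i)"
  shows "\<exists>U\<subseteq>V. card U = k \<and> complete_between E V U"
  using assms
proof (induction i arbitrary: V)
  case (0 V)
  show ?case
  proof (cases "\<forall>v\<in>V. k \<le> degree_in E V v")
    case True
    then show ?thesis using complete_between_if_edge_sparse_min_degree[of V "3 * k" k] 0 by simp
  next
    case False
    then obtain v where v: "v \<in> V" "degree_in E V v < k" by (auto simp: not_le)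
    obtain c where c: "k = c + 2" using 0 by (metis add.commute le_Suc_ex)
    have "locally_sparse k E (V - {v})"
      using edge_sparse_imp_locally_sparse[of V k] locally_sparse_subset[of V k "V - {v}"] 0 by blast
    \<comment> \<open>\<open>2 * c + 3\<close> is \<open>2 * k - 1\<close>: the remaining
      \<open>3 * k - 1\<close> vertices would carry more edges than degeneracy permits.\<close>
    then have "arc_count E (V - {v}) (V - {v}) + k * (k + 1) \<le> 2 * k * (k + (2 * c + 3))"
      using 0 v(1) c by (intro arc_count_le_degenerate) auto
    then show ?thesis
      using arc_count_remove[OF 0(1) v(1)] v(2) 0(6) by (simp add: c algebra_simps)
  qed
next
  case (Suc i V)
  show ?case
  proof (cases "\<forall>v\<in>V. k \<le> degree_in E V v")
    case True
    then show ?thesis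
      using complete_between_if_edge_sparse_min_degree[of V "3 * k + Suc i" k] Suc.prems by simp
  next
    case False
    then obtain v where v: "v \<in> V" "degree_in E V v < k" by (auto simp: not_le)
    let ?W = "V - {v}"
    have W: "finite ?W" "card ?W = 3 * k + i" using Suc.prems(1,2) v(1) by auto
    obtain c where c: "k = c + 2" using Suc.prems(3) by (metis add.commute le_Suc_ex)
    have rem: "arc_count E V V = arc_count E ?W ?W + 2 * degree_in E V v"
      using arc_count_remove[OF Suc.prems(1) v(1)] .
    \<comment> \<open>The count now exceeds the extremal value strictly, so the complete bipartite
      graph that the induction hypothesis provides is already a contradiction.\<close>
    have more: "2 * k * (2 * k + i) + 2 \<le> arc_count E ?W ?W"
      using Suc.prems(5) rem v(2) by (simp add: algebra_simps)
    have "\<exists>U\<subseteq>?W. card U = k \<and> complete_between E ?W U"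
    proof (rule Suc.IH[OF W Suc.prems(3)])
      show "edge_sparse k E ?W" using edge_sparse_subset[OF Suc.prems(1,4)] by blast
      show "2 * k * (2 * k + i) + k * (k + 5) \<le> arc_count E ?W ?W + 2 * (3 * k + i)"
        using Suc.prems(6) rem v(2) by (simp add: algebra_simps)
    qed (use more in simp)
    then have "arc_count E ?W ?W = 2 * k * (2 * k + i)"
      using arc_count_complete_between[OF W(1)] W(2) by auto
    then show ?thesis using more by simp
  qed
qed

end

section \<open>Minimally connected graphs\<close>

text \<open>Separations and cuts are read off from a set that no arc leaves; for the converse, the
  set reachable from a vertex is considered.\<close>

lemma connected_iff_cut:
  assumes sym: "\<And>u v. (u, v) \<in> parcs P \<Longrightarrow> (v, u) \<in> parcs P"
    and wf: "\<And>u v. (u, v) \<in> parcs P \<Longrightarrow> u \<in> pverts P \<and> v \<in> pverts P"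
  shows "connected (with_proj P) \<longleftrightarrow> pverts P \<noteq> {} \<and>
    (\<forall>X\<subseteq>pverts P. X \<noteq> {} \<longrightarrow> X \<noteq> pverts P \<longrightarrow> (\<exists>u\<in>X. \<exists>v\<in>pverts P - X. (u, v) \<in> parcs P))"
    (is "_ \<longleftrightarrow> _ \<and> ?cut")
proof -
  have arcs: "parcs (mk_symmetric (with_proj P)) = parcs P"
    using sym by (auto simp: parcs_mk_symmetric)
  have conn: "connected (with_proj P) \<longleftrightarrow> pverts P \<noteq> {} \<and>
      (\<forall>u\<in>pverts P. \<forall>v\<in>pverts P. (u, v) \<in> rtrancl_on (pverts P) (parcs P))"
    by (simp add: connected_def strongly_connected_def reachable_def arcs)
  have "(\<forall>u\<in>pverts P. \<forall>v\<in>pverts P. (u, v) \<in> rtrancl_on (pverts P) (parcs P)) \<longleftrightarrow> ?cut"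
  proof
    assume reach: "\<forall>u\<in>pverts P. \<forall>v\<in>pverts P. (u, v) \<in> rtrancl_on (pverts P) (parcs P)"
    show ?cut
    proof (intro allI impI)
      fix X assume X: "X \<subseteq> pverts P" "X \<noteq> {}" "X \<noteq> pverts P"
      then obtain u v where uv: "u \<in> X" "v \<in> pverts P - X" by blast
      show "\<exists>u\<in>X. \<exists>v\<in>pverts P - X. (u, v) \<in> parcs P"
      proof (rule ccontr)
        assume closed: "\<not> ?thesis"
        have "(u, v) \<in> rtrancl_on (pverts P) (parcs P)" using reach uv X by blast
        then have "v \<in> X"
        proof (induction rule: rtrancl_on_induct)
          case (step b c)
          then show ?case using closed wf by blast
        qed (use uv in simp)
        then show False using uv by simp
      qed
    qed
  next
    assume cut: ?cut
    show "\<forall>u\<in>pverts P. \<forall>v\<in>pverts P. (u, v) \<in> rtrancl_on (pverts P) (parcs P)"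
    proof (intro ballI)
      fix u v assume uv: "u \<in> pverts P" "v \<in> pverts P"
      define X where "X = {w \<in> pverts P. (u, w) \<in> rtrancl_on (pverts P) (parcs P)}"
      have "u \<in> X" using uv by (simp add: X_def)
      have "X = pverts P"
      proof (rule ccontr)
        assume "X \<noteq> pverts P"
        moreover have "X \<subseteq> pverts P" "X \<noteq> {}" using \<open>u \<in> X\<close> by (auto simp: X_def)
        ultimately obtain a b where ab: "a \<in> X" "b \<in> pverts P - X" "(a, b) \<in> parcs P" using cut by blast
        then have "(u, b) \<in> rtrancl_on (pverts P) (parcs P)"
          by (auto simp: X_def intro: rtrancl_on_into_rtrancl_on)
        then show False using ab(2) by (simp add: X_def)
      qed
      then show "(u, v) \<in> rtrancl_on (pverts P) (parcs P)" using uv(2) by (auto simp: X_def)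
    qed
  qed
  then show ?thesis using conn by blast
qed

section \<open>Deleting vertices and edges\<close>

lemma remove_verts_simps [simp]:
  "pverts (remove_verts G S) = pverts G - S"
  "(u, v) \<in> parcs (remove_verts G S) \<longleftrightarrow> (u, v) \<in> parcs G \<and> u \<notin> S \<and> v \<notin> S"
  by (auto simp: remove_verts_def)

lemma remove_edges_simps [simp]:
  "pverts (remove_edges G F) = pverts G"
  "(u, v) \<in> parcs (remove_edges G F) \<longleftrightarrow> (u, v) \<in> parcs G \<and> {u, v} \<notin> F"
  by (auto simp: remove_edges_def)

lemma remove_edges_empty: "remove_edges G {} = G"
  by (simp add: remove_edges_def)

lemma remove_verts_empty: "remove_verts (remove_edges G F) {} = remove_edges G F"
  by (simp add: remove_edges_def remove_verts_def)

lemma remove_edges_remove_edges: "remove_edges (remove_edges G F) F' = remove_edges G (F \<union> F')"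
  by (auto simp: remove_edges_def)

lemma uedges_remove_edges: "uedges (remove_edges G F) \<subseteq> uedges G"
  by (auto simp: uedges_def remove_edges_def)

lemma k_connectedD:
  "k_connected k G \<Longrightarrow> S \<subseteq> pverts G \<Longrightarrow> card S < k \<Longrightarrow> \<not> disconnected_or_trivial (remove_verts G S)"
proof
  assume "k_connected k G" "S \<subseteq> pverts G" "card S < k" "disconnected_or_trivial (remove_verts G S)"
  then have "connectivity G \<le> card S" unfolding connectivity_def by (intro Least_le) blast
  then show False using \<open>k_connected k G\<close> \<open>card S < k\<close> by (simp add: k_connected_def)
qed

lemma k_edge_connectedD:
  "k_edge_connected k G \<Longrightarrow> F \<subseteq> uedges G \<Longrightarrow> card F < k \<Longrightarrow> \<not> disconnected_or_trivial (remove_edges G F)"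
proof
  assume "k_edge_connected k G" "F \<subseteq> uedges G" "card F < k" "disconnected_or_trivial (remove_edges G F)"
  then have "edge_connectivity G \<le> card F" unfolding edge_connectivity_def by (intro Least_le) blast
  then show False using \<open>k_edge_connected k G\<close> \<open>card F < k\<close> by (simp add: k_edge_connected_def)
qed

text \<open>The \<open>LEAST\<close> is attained because keeping a single vertex is an admissible
  choice.\<close>

lemma not_k_connectedE:
  assumes "\<not> k_connected k G" "pverts G \<noteq> {}"
  obtains S where "S \<subseteq> pverts G" "card S < k" "disconnected_or_trivial (remove_verts G S)"
proof -
  obtain x where "x \<in> pverts G" using assms(2) by blast
  then have "disconnected_or_trivial (remove_verts G (pverts G - {x}))"
    by (simp add: disconnected_or_trivial_def Diff_Diff_Int)
  then have "\<exists>n S. S \<subseteq> pverts G \<and> card S = n \<and> disconnected_or_trivial (remove_verts G S)" by blast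
  from LeastI_ex[OF this] obtain S where
    "S \<subseteq> pverts G" "card S = connectivity G" "disconnected_or_trivial (remove_verts G S)"
    unfolding connectivity_def by blast
  then show ?thesis using that assms(1) by (auto simp: k_connected_def)
qed

text \<open>Here removing all edges shows that the \<open>LEAST\<close> is attained.\<close>

lemma not_k_edge_connectedE:
  assumes "\<not> k_edge_connected k G" "pverts G \<noteq> {}"
    and sym: "\<And>u v. (u, v) \<in> parcs G \<Longrightarrow> (v, u) \<in> parcs G"
    and wf: "\<And>u v. (u, v) \<in> parcs G \<Longrightarrow> u \<in> pverts G \<and> v \<in> pverts G"
  obtains F where "F \<subseteq> uedges G" "card F < k" "disconnected_or_trivial (remove_edges G F)"
proof -
  let ?P = "remove_edges G (uedges G)"
  have empty: "(u, v) \<notin> parcs ?P" for u v by (auto simp: uedges_def)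
  have "disconnected_or_trivial ?P"
  proof (cases "card (pverts G) = 1")
    case False
    obtain x where x: "x \<in> pverts G" using assms(2) by blast
    then have "{x} \<noteq> pverts G" using False by (metis One_nat_def card.empty card.insert empty_iff finite.emptyI)
    moreover have "\<exists>u\<in>{x}. \<exists>v\<in>pverts ?P - {x}. (u, v) \<in> parcs ?P"
      if "connected (with_proj ?P)" "{x} \<noteq> pverts ?P"
    proof -
      have "connected (with_proj ?P) \<longleftrightarrow> pverts ?P \<noteq> {} \<and> (\<forall>X\<subseteq>pverts ?P. X \<noteq> {} \<longrightarrow>
          X \<noteq> pverts ?P \<longrightarrow> (\<exists>u\<in>X. \<exists>v\<in>pverts ?P - X. (u, v) \<in> parcs ?P))"
        by (rule connected_iff_cut) (use empty in blast)+
      then have "{x} \<subseteq> pverts ?P \<longrightarrow> {x} \<noteq> {} \<longrightarrow> {x} \<noteq> pverts ?P \<longrightarrow>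
          (\<exists>u\<in>{x}. \<exists>v\<in>pverts ?P - {x}. (u, v) \<in> parcs ?P)"
        using that(1) by blast
      then show ?thesis using that(2) x by simp
    qed
    ultimately have "\<not> connected (with_proj ?P)" using empty by (metis remove_edges_simps(1))
    then show ?thesis using x by (auto simp: disconnected_or_trivial_def)
  qed (simp add: disconnected_or_trivial_def)
  then have "\<exists>n F. F \<subseteq> uedges G \<and> card F = n \<and> disconnected_or_trivial (remove_edges G F)" by blast
  from LeastI_ex[OF this] obtain F where
    "F \<subseteq> uedges G" "card F = edge_connectivity G" "disconnected_or_trivial (remove_edges G F)"
    unfolding edge_connectivity_def by blast
  then show ?thesis using that assms(1) by (auto simp: k_edge_connected_def)
qed

section \<open>Sparseness of minimally connected graphs\<close>

definition adjacent :: "'a pair_pre_digraph \<Rightarrow> 'a \<Rightarrow> 'a \<Rightarrow> bool" where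
  "adjacent G u v \<longleftrightarrow> (u, v) \<in> parcs G"

context pair_graph
begin

lemma simple_relation_adjacent: "simple_relation (adjacent G)"
proof
  show "adjacent G u v \<Longrightarrow> adjacent G v u" for u v unfolding adjacent_def by (rule arcs_symmetric)
  show "\<not> adjacent G v v" for v unfolding adjacent_def using no_loops'[of v v] by blast
qed

lemma parcs_in_verts: "(u, v) \<in> parcs G \<Longrightarrow> u \<in> pverts G \<and> v \<in> pverts G"
  using in_arcsD1 in_arcsD2 by blast

text \<open>Combining both deletions covers \<open>G - S\<close> and \<open>G - F\<close> through an
  empty set, and the mixed deletion of an edge and \<open>S\<close>.\<close>

lemma connected_remove_verts_iff:
  "connected (with_proj (remove_verts (remove_edges G F) S)) \<longleftrightarrow> pverts G - S \<noteq> {} \<and>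
    (\<forall>X\<subseteq>pverts G - S. X \<noteq> {} \<longrightarrow> X \<noteq> pverts G - S \<longrightarrow>
      (\<exists>u\<in>X. \<exists>v\<in>pverts G - S - X. (u, v) \<in> parcs G \<and> {u, v} \<notin> F))"
proof -
  have "connected (with_proj (remove_verts (remove_edges G F) S)) \<longleftrightarrow>
    pverts (remove_verts (remove_edges G F) S) \<noteq> {} \<and>
    (\<forall>X\<subseteq>pverts (remove_verts (remove_edges G F) S). X \<noteq> {} \<longrightarrow> X \<noteq> pverts (remove_verts (remove_edges G F) S) \<longrightarrow>
      (\<exists>u\<in>X. \<exists>v\<in>pverts (remove_verts (remove_edges G F) S) - X. (u, v) \<in> parcs (remove_verts (remove_edges G F) S)))"
    by (rule connected_iff_cut) (use arcs_symmetric parcs_in_verts in \<open>auto simp: insert_commute\<close>)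
  moreover have eq: "(\<exists>u\<in>X. \<exists>v\<in>pverts G - S - X. (u, v) \<in> parcs (remove_verts (remove_edges G F) S)) \<longleftrightarrow>
      (\<exists>u\<in>X. \<exists>v\<in>pverts G - S - X. (u, v) \<in> parcs G \<and> {u, v} \<notin> F)" if "X \<subseteq> pverts G - S" for X
    unfolding remove_verts_simps remove_edges_simps using that by blast
  ultimately show ?thesis
    by (simp only: remove_verts_simps(1) remove_edges_simps(1) eq cong: imp_cong)
qed

lemma finite_uedges: "finite (uedges G)"
  unfolding uedges_def using pair_finite_arcs by simp

text \<open>The form in which \<open>Mader_cycle\<close> uses connectivity.\<close>

lemma k_connected_separator:
  assumes "k_connected k G" "A \<subseteq> pverts G" "S \<subseteq> pverts G" "A \<inter> S = {}" "A \<noteq> {}" "pverts G - A - S \<noteq> {}"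
    and "\<And>u w. u \<in> A \<Longrightarrow> w \<in> pverts G - A - S \<Longrightarrow> \<not> adjacent G u w"
  shows "k \<le> card S"
proof (rule ccontr)
  assume "\<not> k \<le> card S"
  then have "\<not> disconnected_or_trivial (remove_verts G S)" using k_connectedD[OF assms(1,3)] by simp
  then have "connected (with_proj (remove_verts (remove_edges G {}) S))"
    using assms(5,6) by (auto simp: disconnected_or_trivial_def remove_edges_empty)
  moreover have "A \<subseteq> pverts G - S" "A \<noteq> pverts G - S" using assms(2,4,6) by auto
  ultimately obtain u v where "u \<in> A" "v \<in> pverts G - S - A" "(u, v) \<in> parcs G"
    using assms(5) unfolding connected_remove_verts_iff by meson
  then show False using assms(7)[of u v] by (auto simp: adjacent_def)
qed

text \<open>Fewer than \<open>k\<close> vertices \<open>S\<close> disconnect the graph without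
  \<open>xy\<close> but not \<open>G\<close> itself, so \<open>xy\<close> is the only edge between
  the two sides.\<close>

lemma locally_sparse_if_minimally_k_connected:
  assumes "minimally_k_connected k G"
  shows "locally_sparse k (adjacent G) (pverts G)"
  unfolding locally_sparse_def
proof (intro ballI impI)
  fix x y assume xy: "x \<in> pverts G" "y \<in> pverts G" "adjacent G x y"
  have kc: "k_connected k G" using assms by (simp add: minimally_k_connected_def)
  have "{x, y} \<in> uedges G" using xy(3) by (force simp: uedges_def adjacent_def)
  then have "\<not> k_connected k (remove_edges G {{x, y}})" using assms by (simp add: minimally_k_connected_def)
  then obtain S where S: "S \<subseteq> pverts G" "card S < k"
    and disc: "disconnected_or_trivial (remove_verts (remove_edges G {{x, y}}) S)"
    by (rule not_k_connectedE) (use xy in auto)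
  \<comment> \<open>Deleting \<open>xy\<close> keeps the vertex set, so the single-vertex
    alternative is excluded and the graph left is really disconnected.\<close>
  have nd: "\<not> disconnected_or_trivial (remove_verts G S)" using k_connectedD[OF kc S] .
  then have V: "pverts G - S \<noteq> {}" and nc: "\<not> connected (with_proj (remove_verts (remove_edges G {{x, y}}) S))"
    using disc by (auto simp: disconnected_or_trivial_def)
  then have c: "connected (with_proj (remove_verts (remove_edges G {}) S))"
    using nd by (auto simp: disconnected_or_trivial_def remove_edges_empty)
  obtain X where X: "X \<subseteq> pverts G - S" "X \<noteq> {}" "X \<noteq> pverts G - S"
    and X_cross: "\<forall>u\<in>X. \<forall>v\<in>pverts G - S - X. (u, v) \<in> parcs G \<longrightarrow> {u, v} \<in> {{x, y}}"
    using nc V unfolding connected_remove_verts_iff by blast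
  have cross: "{u, v} = {x, y}" if "u \<in> X" "v \<in> pverts G - S - X" "(u, v) \<in> parcs G" for u v
    using X_cross that by blast
  obtain u v where uv: "u \<in> X" "v \<in> pverts G - S - X" "(u, v) \<in> parcs G"
    using c X unfolding connected_remove_verts_iff by meson
  have cross': "{w, w'} = {x, y}" if "w \<in> pverts G - S - X" "w' \<in> X" "(w, w') \<in> parcs G" for w w'
    using cross[OF that(2,1) arcs_symmetric[OF that(3)]] by auto
  have "{u, v} = {x, y}" using cross[OF uv] .
  then consider "x \<in> X" "y \<in> pverts G - S - X" | "y \<in> X" "x \<in> pverts G - S - X"
    using uv by (auto simp: doubleton_eq_iff)
  then have "\<exists>A B. separates (adjacent G) (pverts G) A S B x y"
  proof cases
    case 1
    have "separates (adjacent G) (pverts G) X S (pverts G - S - X) x y"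
      unfolding separates_def adjacent_def
      using 1 X S(1) cross by (auto simp: doubleton_eq_iff; blast)
    then show ?thesis by blast
  next
    case 2
    have "separates (adjacent G) (pverts G) (pverts G - S - X) S X x y"
      unfolding separates_def adjacent_def
      using 2 X S(1) cross' by (auto simp: doubleton_eq_iff; blast)
    then show ?thesis by blast
  qed
  then show "\<exists>A S B. separates (adjacent G) (pverts G) A S B x y \<and> card S < k" using S(2) by blast
qed

text \<open>The cut left after deleting \<open>xy\<close> and fewer than \<open>k\<close> edges
  \<open>F\<close> consists of edges of \<open>F\<close> and of \<open>xy\<close>. As
  \<open>F\<close> alone does not disconnect \<open>G\<close>, the edge \<open>xy\<close> does cross
  it.\<close>

lemma edge_sparse_if_minimally_k_edge_connected:
  assumes "minimally_k_edge_connected k G"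
  shows "edge_sparse k (adjacent G) (pverts G)"
  unfolding edge_sparse_def
proof (intro ballI impI)
  fix x y assume xy: "x \<in> pverts G" "y \<in> pverts G" "adjacent G x y"
  let ?e = "{x, y}"
  have kc: "k_edge_connected k G" using assms by (simp add: minimally_k_edge_connected_def)
  have e: "?e \<in> uedges G" using xy(3) by (force simp: uedges_def adjacent_def)
  then have "\<not> k_edge_connected k (remove_edges G {?e})" using assms by (simp add: minimally_k_edge_connected_def)
  then obtain F where F: "F \<subseteq> uedges (remove_edges G {?e})" "card F < k"
    and disc: "disconnected_or_trivial (remove_edges (remove_edges G {?e}) F)"
    by (rule not_k_edge_connectedE) (use xy arcs_symmetric parcs_in_verts in \<open>auto simp: insert_commute\<close>)
  have FG: "F \<subseteq> uedges G" using F(1) uedges_remove_edges by blast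
  have finF: "finite F" using FG finite_uedges finite_subset by blast
  have nd: "\<not> disconnected_or_trivial (remove_edges G F)" using k_edge_connectedD[OF kc FG F(2)] .
  then have nc: "\<not> connected (with_proj (remove_verts (remove_edges G ({?e} \<union> F)) {}))"
    using disc by (auto simp: disconnected_or_trivial_def remove_edges_remove_edges remove_verts_empty)
  have c: "connected (with_proj (remove_verts (remove_edges G F) {}))"
    using nd xy(1) by (auto simp: disconnected_or_trivial_def remove_verts_empty)
  obtain X where X: "X \<subseteq> pverts G" "X \<noteq> {}" "X \<noteq> pverts G"
    and X_cross: "\<forall>u\<in>X. \<forall>v\<in>pverts G - X. (u, v) \<in> parcs G \<longrightarrow> {u, v} \<in> {?e} \<union> F"
    using nc xy(1) unfolding connected_remove_verts_iff Diff_empty by blast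
  have cross: "{u, v} \<in> insert ?e F" if "u \<in> X" "v \<in> pverts G - X" "(u, v) \<in> parcs G" for u v
    using X_cross that by blast
  obtain u v where uv: "u \<in> X" "v \<in> pverts G - X" "(u, v) \<in> parcs G" "{u, v} \<notin> F"
    using c X unfolding connected_remove_verts_iff Diff_empty by meson
  have uv_e: "{u, v} = ?e" using cross[OF uv(1-3)] uv(4) by blast
  have bound: "arc_count (adjacent G) X (pverts G - X) \<le> k"
  proof -
    let ?C = "{(u, w). u \<in> X \<and> w \<in> pverts G - X \<and> adjacent G u w}"
    have "inj_on (\<lambda>(u, w). {u, w}) ?C" by (auto simp: inj_on_def doubleton_eq_iff)
    then have "card ?C = card ((\<lambda>(u, w). {u, w}) ` ?C)" by (simp add: card_image)
    also have "\<dots> \<le> card (insert ?e F)"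
      using finF cross by (intro card_mono) (auto simp: adjacent_def)
    also have "\<dots> \<le> k" using F(2) finF by (simp add: card_insert_if)
    finally show ?thesis
      using arc_count_eq_card[of X "pverts G - X" "adjacent G"] finite_subset[OF X(1) pair_finite_verts]
        pair_finite_verts by simp
  qed
  have bound': "arc_count (adjacent G) (pverts G - X) X \<le> k"
    using bound simple_relation.arc_count_commute[OF simple_relation_adjacent, of X "pverts G - X"]
      finite_subset[OF X(1) pair_finite_verts] pair_finite_verts by simp
  consider "x \<in> X" "y \<in> pverts G - X" | "y \<in> X" "x \<in> pverts G - X"
    using uv uv_e by (auto simp: doubleton_eq_iff)
  then show "\<exists>A\<subseteq>pverts G. x \<in> A \<and> y \<in> pverts G - A \<and> arc_count (adjacent G) A (pverts G - A) \<le> k"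
  proof cases
    case 1
    then show ?thesis using bound X(1) by blast
  next
    case 2
    then show ?thesis using bound' X(1) by (intro exI[of _ "pverts G - X"]) (auto simp: double_diff)
  qed
qed

lemma arc_count_eq_uedges: "arc_count (adjacent G) (pverts G) (pverts G) = 2 * card (uedges G)"
proof -
  have "{(u, w). u \<in> pverts G \<and> w \<in> pverts G \<and> adjacent G u w} = parcs G"
    using parcs_in_verts by (auto simp: adjacent_def)
  then have "arc_count (adjacent G) (pverts G) (pverts G) = card (parcs G)"
    using arc_count_eq_card[OF pair_finite_verts pair_finite_verts] by simp
  also have "\<dots> = (\<Sum>e\<in>uedges G. \<Sum>a\<in>{a \<in> parcs G. (\<lambda>(u, v). {u, v}) a = e}. 1)"
    unfolding uedges_def using sum.image_gen[OF pair_finite_arcs, of "\<lambda>_. 1::nat"] by simp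
  also have "\<dots> = (\<Sum>e\<in>uedges G. 2)"
  proof (rule sum.cong[OF refl])
    fix e assume "e \<in> uedges G"
    then obtain u v where uv: "(u, v) \<in> parcs G" "e = {u, v}" by (auto simp: uedges_def)
    then have "{a \<in> parcs G. (\<lambda>(u, v). {u, v}) a = e} = {(u, v), (v, u)}"
      using arcs_symmetric by (auto simp: doubleton_eq_iff)
    then show "(\<Sum>a\<in>{a \<in> parcs G. (\<lambda>(u, v). {u, v}) a = e}. 1) = (2::nat)"
      using no_loops'[OF uv(1)] by simp
  qed
  finally show ?thesis by simp
qed

lemma complete_bipartite_iff:
  "K\<^bsub>m,card (pverts G) - m\<^esub> (with_proj G) \<longleftrightarrow>
    m \<le> card (pverts G) \<and> (\<exists>U\<subseteq>pverts G. card U = m \<and> complete_between (adjacent G) (pverts G) U)"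
proof
  assume "K\<^bsub>m,card (pverts G) - m\<^esub> (with_proj G)"
  then obtain U W where UW: "pverts G = U \<union> W" "U \<inter> W = {}" "card U = m" "parcs G = U \<times> W \<union> W \<times> U"
    unfolding complete_bipartite_digraph_pair_def by blast
  have "complete_between (adjacent G) (pverts G) U"
    unfolding complete_between_def adjacent_def UW(4) using UW(1,2) by auto
  moreover have "m \<le> card (pverts G)"
    unfolding UW(3)[symmetric] using UW(1) pair_finite_verts by (intro card_mono) auto
  ultimately show "m \<le> card (pverts G) \<and>
      (\<exists>U\<subseteq>pverts G. card U = m \<and> complete_between (adjacent G) (pverts G) U)" using UW by blast
next
  assume "m \<le> card (pverts G) \<and> (\<exists>U\<subseteq>pverts G. card U = m \<and> complete_between (adjacent G) (pverts G) U)"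
  then obtain U where U: "U \<subseteq> pverts G" "card U = m" "complete_between (adjacent G) (pverts G) U" by blast
  have "parcs G = U \<times> (pverts G - U) \<union> (pverts G - U) \<times> U"
  proof (intro set_eqI)
    fix a :: "'a \<times> 'a"
    obtain u v where a: "a = (u, v)" by (cases a)
    show "a \<in> parcs G \<longleftrightarrow> a \<in> U \<times> (pverts G - U) \<union> (pverts G - U) \<times> U"
      unfolding a using U(1,3) parcs_in_verts[of u v] by (auto simp: complete_between_def adjacent_def)
  qed
  moreover have "card (pverts G - U) = card (pverts G) - m"
    using U pair_finite_verts finite_subset by (metis card_Diff_subset)
  moreover have "pverts G = U \<union> (pverts G - U)" using U(1) by auto
  ultimately show "K\<^bsub>m,card (pverts G) - m\<^esub> (with_proj G)"
    unfolding complete_bipartite_digraph_pair_def using U(2) pair_finite_verts by blast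
qed

end

section \<open>Extremal subgraphs of minimally connected graphs\<close>

text \<open>Assuming only a lower bound on the edges settles both the inequality and its equality
  case. Mader's argument needs the connectivity of \<open>G\<close>, so it is run there: vertices of
  degree above \<open>k\<close> in \<open>H\<close> have degree above \<open>k\<close> in
  \<open>G\<close>, and \<open>H\<close> inherits the forest.\<close>

lemma card_uedges_extremal:
  assumes G: "pair_graph G" and H: "pair_graph H" and sub: "subgraph (with_proj H) (with_proj G)"
    and min: "minimally_k_connected k G \<or> minimally_k_edge_connected k G"
    and k: "2 \<le> k" and large: "k * (k + 5) \<le> 2 * card (pverts H)"
    and many: "k * (card (pverts H) - k) \<le> card (uedges H)"
  shows "K\<^bsub>k,card (pverts H) - k\<^esub> (with_proj H)"
proof -
  interpret G: pair_graph G by fact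
  interpret H: pair_graph H by fact
  interpret RG: simple_relation "adjacent G" by (rule G.simple_relation_adjacent)
  interpret RH: simple_relation "adjacent H" by (rule H.simple_relation_adjacent)
  have V: "pverts H \<subseteq> pverts G" and adj: "\<And>u v. adjacent H u v \<Longrightarrow> adjacent G u v"
    using sub by (auto simp: subgraph_def adjacent_def)
  have fin: "finite (pverts H)" "finite (pverts G)" by (rule H.pair_finite_verts G.pair_finite_verts)+
  have adj_degree: "degree_in (adjacent H) W v \<le> degree_in (adjacent G) W v" if "finite W" for W v
    using that adj by (rule degree_in_rel_mono)
  have many': "2 * k * (card (pverts H) - k) \<le> arc_count (adjacent H) (pverts H) (pverts H)"
    using many by (simp add: H.arc_count_eq_uedges)
  have k3: "3 * k \<le> card (pverts H)"
  proof -
    obtain c where "k = c + 2" using k by (metis add.commute le_Suc_ex)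
    then show ?thesis using large by (simp add: algebra_simps)
  qed
  have "\<exists>U\<subseteq>pverts H. card U = k \<and> complete_between (adjacent H) (pverts H) U"
    using min
  proof
    assume mk: "minimally_k_connected k G"
    then have kc: "k_connected k G" by (simp add: minimally_k_connected_def)
    have sparse: "locally_sparse k (adjacent G) (pverts G)"
      using G.locally_sparse_if_minimally_k_connected[OF mk] .
    let ?M = "{v \<in> pverts H. k < degree_in (adjacent H) (pverts H) v}"
    have degG: "k < degree_in (adjacent G) (pverts G) v" if "v \<in> ?M" for v
      using that adj_degree[OF fin(1)] degree_in_mono[OF fin(2) V, of "adjacent G" v]
      by (metis (mono_tags, lifting) le_less_trans less_le_trans mem_Collect_eq)
    have acyclic: "\<exists>v\<in>W. degree_in (adjacent H) W v \<le> 1" if W: "W \<subseteq> ?M" "W \<noteq> {}" for W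
    proof -
      have "\<exists>v\<in>W. degree_in (adjacent G) W v \<le> 1"
      proof (rule RG.Mader_cycle[OF fin(2) _ sparse _ W(2)])
        show "W \<subseteq> pverts G" using W(1) V by auto
        show "k < degree_in (adjacent G) (pverts G) v" if "v \<in> W" for v using degG that W(1) by auto
      qed (rule G.k_connected_separator[OF kc])
      moreover have "finite W" using W(1) fin(1) finite_subset by fastforce
      ultimately show ?thesis using adj_degree le_trans by meson
    qed
    show ?thesis
    proof (rule RH.complete_between_if_high_forest[OF fin(1) _ k refl large _ many'])
      show "locally_sparse k (adjacent H) (pverts H)"
        using fin(2) sparse V adj by (rule locally_sparse_mono)
      show "arc_count (adjacent H) ?M ?M + 2 \<le> 2 * card ?M" if "?M \<noteq> {}"
        using fin(1) that acyclic by (intro RH.arc_count_forest) auto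
    qed
  next
    assume mk: "minimally_k_edge_connected k G"
    have sparse: "edge_sparse k (adjacent H) (pverts H)"
      using fin(2) G.edge_sparse_if_minimally_k_edge_connected[OF mk] V adj by (rule edge_sparse_mono)
    obtain i where i: "card (pverts H) = 3 * k + i" using k3 le_Suc_ex by blast
    show ?thesis
    proof (rule RH.complete_between_if_edge_sparse[OF fin(1) i k sparse])
      show "2 * k * (2 * k + i) \<le> arc_count (adjacent H) (pverts H) (pverts H)"
        using many' i by simp
      then show "2 * k * (2 * k + i) + k * (k + 5)
          \<le> arc_count (adjacent H) (pverts H) (pverts H) + 2 * (3 * k + i)"
        using large unfolding i by (rule add_mono)
    qed
  qed
  then show ?thesis using k3 by (simp add: H.complete_bipartite_iff)
qed

theorem theorem1p1:
  fixes k :: nat and G H :: "'a pair_pre_digraph"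
  assumes "k \<ge> 1"
    and "pair_graph G"
    and "minimally_k_connected k G \<or> minimally_k_edge_connected k G"
    and "pair_graph H" and "pverts H \<noteq> {}"
    and "subgraph (with_proj H) (with_proj G)"
  shows "real (card (uedges H)) \<le> real k * (real (card (pverts H)) - 1) \<and>
    (real (card (pverts H)) \<ge> 1 / 2 * real k * (real k + 5) \<longrightarrow>
       real (card (uedges H)) \<le> real k * (real (card (pverts H)) - real k) \<and>
       (K\<^bsub>k,card (pverts H) - k\<^esub> (with_proj H) \<longrightarrow>
         real (card (uedges H)) = real k * (real (card (pverts H)) - real k)) \<and>
       (k \<ge> 2 \<longrightarrow>
         (real (card (uedges H)) = real k * (real (card (pverts H)) - real k) \<longleftrightarrow>
          K\<^bsub>k,card (pverts H) - k\<^esub> (with_proj H))))"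
proof -
  interpret G: pair_graph G by fact
  interpret H: pair_graph H by fact
  interpret RG: simple_relation "adjacent G" by (rule G.simple_relation_adjacent)
  interpret RH: simple_relation "adjacent H" by (rule H.simple_relation_adjacent)
  define n where "n = card (pverts H)"
  define e where "e = card (uedges H)"
  have V: "pverts H \<subseteq> pverts G" and adj: "\<And>u v. adjacent H u v \<Longrightarrow> adjacent G u v"
    using assms(6) by (auto simp: subgraph_def adjacent_def)
  have "locally_sparse k (adjacent G) (pverts G)"
    using assms(3) G.locally_sparse_if_minimally_k_connected
      RG.edge_sparse_imp_locally_sparse[OF G.pair_finite_verts]
      G.edge_sparse_if_minimally_k_edge_connected by blast
  with G.pair_finite_verts have sparse: "locally_sparse k (adjacent H) (pverts H)"
    using V adj by (rule locally_sparse_mono)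
  have n: "n = Suc (n - 1)"
    using assms(5) H.pair_finite_verts by (simp add: n_def card_gt_0_iff)
  have "2 * e \<le> 2 * k * (n - 1)"
    using RH.arc_count_le_linear[OF H.pair_finite_verts _ sparse, of "n - 1"] n
    unfolding H.arc_count_eq_uedges n_def e_def by simp
  then have "e \<le> k * (n - 1)" by simp
  then have "real e \<le> real (k * (n - 1))" by (rule of_nat_mono)
  also have "\<dots> = real k * (real n - 1)" using n by (simp add: of_nat_diff)
  finally have first: "real e \<le> real k * (real n - 1)" .
  have complete: "e = k * (n - k)" if "K\<^bsub>k,n - k\<^esub> (with_proj H)"
  proof -
    note K = that
    obtain U where "U \<subseteq> pverts H" "card U = k" "complete_between (adjacent H) (pverts H) U"
      using H.complete_bipartite_iff[THEN iffD1, OF K[unfolded n_def]] by auto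
    then show ?thesis
      using RH.arc_count_complete_between[OF H.pair_finite_verts]
      unfolding H.arc_count_eq_uedges n_def e_def by auto
  qed
  have second: "real e \<le> real k * (real n - real k) \<and>
      (K\<^bsub>k,n - k\<^esub> (with_proj H) \<longrightarrow> real e = real k * (real n - real k)) \<and>
      (k \<ge> 2 \<longrightarrow> (real e = real k * (real n - real k) \<longleftrightarrow> K\<^bsub>k,n - k\<^esub> (with_proj H)))"
    if large: "1 / 2 * real k * (real k + 5) \<le> real n"
  proof -
    have "real (k * (k + 5)) \<le> real (2 * n)" using large by simp
    then have large': "k * (k + 5) \<le> 2 * n" by (simp only: of_nat_le_iff)
    \<comment> \<open>This leads to \<open>k \<le> n\<close>, so that the truncated difference
      \<open>n - k\<close> agrees with the real one.\<close>
    have "6 * k \<le> k * (k + 5)" using assms(1) mult_le_mono[of 6 "k + 5" k k] by (simp add: mult.commute)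
    then have "6 * k \<le> 2 * n" using large' by (rule le_trans)
    then have kn: "k \<le> n" by simp
    have real_eq: "real (k * (n - k)) = real k * (real n - real k)" using kn by (simp add: of_nat_diff)
    have extremal: "K\<^bsub>k,n - k\<^esub> (with_proj H)" if "2 \<le> k" "k * (n - k) \<le> e"
      using card_uedges_extremal[OF assms(2,4,6,3) that(1)] large' that(2) unfolding n_def e_def by blast
    have "e \<le> k * (n - k)"
    \<comment> \<open>For \<open>k = 1\<close> the two claimed bounds coincide.\<close>
    proof (cases "k = 1")
      case True
      then show ?thesis using \<open>e \<le> k * (n - 1)\<close> by simp
    next
      case False
      show ?thesis
      proof (rule ccontr)
        assume more: "\<not> e \<le> k * (n - k)"
        then have "K\<^bsub>k,n - k\<^esub> (with_proj H)" using extremal False assms(1) by simp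
        then show False using complete more by simp
      qed
    qed
    then have "real e \<le> real k * (real n - real k)" unfolding real_eq[symmetric] by (simp only: of_nat_le_iff)
    moreover have "real e = real k * (real n - real k) \<longleftrightarrow> e = k * (n - k)"
      unfolding real_eq[symmetric] by (simp only: of_nat_eq_iff)
    \<comment> \<open>For \<open>k = 1\<close> a path on four vertices attains the bound without
      being a star, so the characterisation starts at \<open>k = 2\<close>.\<close>
    moreover have "e = k * (n - k) \<longleftrightarrow> K\<^bsub>k,n - k\<^esub> (with_proj H)" if "2 \<le> k"
      using extremal[OF that] complete by auto
    ultimately show ?thesis using complete by blast
  qed
  show ?thesis using first second unfolding n_def e_def by blast
qed

end
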